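(* Show that $C_{54}(1,3,17,19)$ and $C_{54}(7,11,15,25)$ are isomorphic but they are neither Type-1 isomorphic nor Type-2 isomorphic with respect to $m=3$. Also, find the isomorphic set and some isomorphism series of the two (isomorphic) circulant graphs.
   Context: For $n\in\mathbb{N}$ and a set $R\subseteq[1,\frac n2]$ of positive integers (jump sizes), $C_n(R)$ is the circulant graph with vertices $v_0,\dots,v_{n-1}$ and edges $(v_i,v_{i+r})$ for $i\in\mathbb{Z}_n$, $r\in R$, subscripts modulo $n$; $C_n(r_1,\dots,r_k)$ means $C_n(\{r_1,\dots,r_k\})$. Circulant graphs are identified by their order and jump size set. Reflexive reduction modulo $n$: reduce each integer modulo $n$ and replace any result $r'$ with $r'>\frac n2$ by $n-r'$. Let $\varphi_n$ be the set of integers $x$, taken modulo $n$, with $\gcd(n,x)=1$. For $x\in\varphi_n$, $xR$ denotes the reflexive reduction modulo $n$ of $\{xr: r\in R\}$. Type-1 isomorphism (Adam's isomorphism): $C_n(R)$ and $C_n(S)$ are Type-1 isomorphic if $S=xR$ for some $x\in\varphi_n$. Type-2 isomorphism: let $|R|\ge 3$, $r\in R$, and $m>1$ be such that $m$ divides $\gcd(n,r)$ and $m^3$ divides $n$. Let $K_n$ be the complete graph on $u_0,\dots,u_{n-1}$. For $0\le t\le \frac nm-1$ define the one-to-one map $\theta_{n,m,t}:V(C_n(R))\to V(K_n)$ by $\theta_{n,m,t}(v_x)=u_{x+jtm}$ (subscripts modulo $n$), where $x=qm+j$, $0\le j\le m-1$, $0\le q\le\frac nm-1$. It acts on edges by $\theta_{n,m,t}((v_x,v_{x+s}))=(\theta_{n,m,t}(v_x),\theta_{n,m,t}(v_{x+s}))$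 for $s\in R$, and $\theta_{n,m,t}(C_n(R))$ is the resulting graph on $u_0,\dots,u_{n-1}$. If for some $t$ one has $\theta_{n,m,t}(C_n(R))=C_n(S)$ (the circulant graph on $u_0,\dots,u_{n-1}$) for some $S$ and $S\ne yR$ for all $y\in\varphi_n$, then $C_n(R)$ and $C_n(S)$ are called Type-2 isomorphic with respect to $m$. When $C_n(R)$ and $C_n(S)$ are Type-2 isomorphic with respect to $m$, one also says, for $k\in\mathbb{N}$, that $C_{kn}(kR)$ and $C_{kn}(kS)$ are Type-2 isomorphic with respect to $m$. The isomorphic set of $C_n(R)$ is the set of all circulant graphs isomorphic to $C_n(R)$; isomorphic circulant graphs have the same isomorphic set, and this common set is the isomorphic set of the two graphs. An isomorphism series of $C_n(R)$ is a series of isomorphic circulant graphs starting from $C_n(R)$ such that (i) any two consecutive members are either Type-1 isomorphic or Type-2 isomorphic and (ii) Type-1 isomorphism and Type-2 isomorphism occur alternately in the series. Only simple isomorphism series are considered, that is, those in which no two consecutive elements of the series repeat with the same type of isomorphism. *)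

theory Defs
  imports "HOL-Number_Theory.Totient"
begin

text \<open>A graph is a pair of a vertex set and a set of edges, an edge being the set of its two ends.\<close>

type_synonym 'a ugraph = "'a set \<times> 'a set set"

definition verts :: "'a ugraph \<Rightarrow> 'a set" where
  "verts G = fst G"

definition edges :: "'a ugraph \<Rightarrow> 'a set set" where
  "edges G = snd G"

definition graph_isomorphic :: "'a ugraph \<Rightarrow> 'b ugraph \<Rightarrow> bool" where
  "graph_isomorphic G H \<longleftrightarrow>
     (\<exists>f. bij_betw f (verts G) (verts H) \<and>
          (\<forall>u\<in>verts G. \<forall>v\<in>verts G. {u, v} \<in> edges G \<longleftrightarrow> {f u, f v} \<in> edges H))"

definition map_graph :: "('a \<Rightarrow> 'b) \<Rightarrow> 'a ugraph \<Rightarrow> 'b ugraph" where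
  "map_graph f G = (f ` verts G, (\<lambda>e. f ` e) ` edges G)"

text \<open>A circulant graph is identified by its order and its jump size set, so the pair \<open>(n, R)\<close>
  stands for \<open>C\<^sub>n(R)\<close>.  The vertex \<open>v\<^sub>i\<close> (and likewise \<open>u\<^sub>i\<close>) is represented by its index.\<close>

type_synonym circulant = "nat \<times> nat set"

definition is_circulant :: "circulant \<Rightarrow> bool" where
  "is_circulant C \<longleftrightarrow> 0 < fst C \<and> (\<forall>r\<in>snd C. 1 \<le> r \<and> 2 * r \<le> fst C)"

fun circulant_graph :: "circulant \<Rightarrow> nat ugraph" where
  "circulant_graph (n, R) = ({0..<n}, {{i, (i + r) mod n} | i r. i < n \<and> r \<in> R})"

definition isomorphic :: "circulant \<Rightarrow> circulant \<Rightarrow> bool" where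
  "isomorphic C D \<longleftrightarrow> graph_isomorphic (circulant_graph C) (circulant_graph D)"

definition isomorphic_set :: "circulant \<Rightarrow> circulant set" where
  "isomorphic_set C = {D. is_circulant D \<and> isomorphic C D}"

definition reflexive_reduction :: "nat \<Rightarrow> nat \<Rightarrow> nat" where
  "reflexive_reduction n k = (let r = k mod n in if 2 * r > n then n - r else r)"

definition mult_jumps :: "nat \<Rightarrow> nat \<Rightarrow> nat set \<Rightarrow> nat set" where
  "mult_jumps n x R = (\<lambda>r. reflexive_reduction n (x * r)) ` R"

text \<open>The set \<open>\<phi>\<^sub>n\<close> of residues coprime to \<open>n\<close> is \<^const>\<open>totatives\<close> \<open>n\<close>, which picks the
  representatives in \<open>{1..n}\<close>.\<close>

inductive type1_iso :: "circulant \<Rightarrow> circulant \<Rightarrow> bool" where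
  "type1_iso (n, R) (n, S)"
    if "is_circulant (n, R)" "is_circulant (n, S)"
       "x \<in> totatives n" "S = mult_jumps n x R"

text \<open>For \<open>x = q * m + j\<close> with \<open>0 \<le> j < m\<close>, the index \<open>x + j * t * m\<close> uses \<open>j = x mod m\<close>.\<close>

definition theta :: "nat \<Rightarrow> nat \<Rightarrow> nat \<Rightarrow> nat \<Rightarrow> nat" where
  "theta n m t x = (x + (x mod m) * t * m) mod n"

text \<open>The rule \<open>scale\<close> is the convention that a Type-2 isomorphism of \<open>C\<^sub>n(R)\<close> and \<open>C\<^sub>n(S)\<close> is
  also called one of \<open>C\<^sub>k\<^sub>n(kR)\<close> and \<open>C\<^sub>k\<^sub>n(kS)\<close>, with respect to the same \<open>m\<close>.\<close>

inductive type2_iso :: "nat \<Rightarrow> circulant \<Rightarrow> circulant \<Rightarrow> bool" for m :: nat where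
  base: "type2_iso m (n, R) (n, S)"
    if "is_circulant (n, R)" "is_circulant (n, S)"
       "card R \<ge> 3" "r \<in> R" "m > 1" "m dvd gcd n r" "m ^ 3 dvd n"
       "t \<le> n div m - 1"
       "map_graph (theta n m t) (circulant_graph (n, R)) = circulant_graph (n, S)"
       "\<forall>y\<in>totatives n. S \<noteq> mult_jumps n y R"
| scale: "type2_iso m (k * n, (\<lambda>r. k * r) ` R) (k * n, (\<lambda>s. k * s) ` S)"
    if "type2_iso m (n, R) (n, S)" "k \<ge> 1"

datatype iso_type = Type1 | Type2

fun iso_of_type :: "iso_type \<Rightarrow> circulant \<Rightarrow> circulant \<Rightarrow> bool" where
  "iso_of_type Type1 C D = type1_iso C D"
| "iso_of_type Type2 C D = (\<exists>m. type2_iso m C D)"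

text \<open>In \<open>isomorphism_series C Cs ts\<close> the list \<open>Cs\<close> is the series and \<open>ts ! i\<close> is the type of the
  isomorphism from \<open>Cs ! i\<close> to \<open>Cs ! Suc i\<close>.  The last conjunct is simplicity: the same (unordered)
  pair of consecutive members does not occur twice with the same type.\<close>

definition isomorphism_series :: "circulant \<Rightarrow> circulant list \<Rightarrow> iso_type list \<Rightarrow> bool" where
  "isomorphism_series C Cs ts \<longleftrightarrow>
     length Cs = Suc (length ts) \<and> Cs ! 0 = C \<and>
     (\<forall>D\<in>set Cs. is_circulant D \<and> isomorphic C D) \<and>
     (\<forall>i<length ts. iso_of_type (ts ! i) (Cs ! i) (Cs ! Suc i)) \<and>
     (\<forall>i. Suc i < length ts \<longrightarrow> ts ! Suc i \<noteq> ts ! i) \<and>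
     (\<forall>i j. i < j \<and> j < length ts \<and> ts ! i = ts ! j \<longrightarrow>
        {Cs ! i, Cs ! Suc i} \<noteq> {Cs ! j, Cs ! Suc j})"

end

theory Submission
  imports Defs
begin

text \<open>
  All graphs involved belong to one family.  For \<open>u \<in> {1, 5, 7}\<close> and
  \<open>w \<in> {3, 15, 21}\<close> let \<open>circ u w\<close> be the circulant graph of order 54 with jumps
  \<open>u\<close>, \<open>18 - u\<close>, \<open>18 + u\<close> and \<open>w\<close>.  Two vertices are adjacent there iff their difference is
  \<open>\<plusminus>u\<close> modulo 18 or \<open>\<plusminus>w\<close> modulo 54: one jump class is a full coset of \<open>18\<int>\<close> up to sign, the
  other a single residue divisible by 3 (lemma \<open>jump_circ\<close>).  The given graphs are
  \<open>circ 1 3\<close> and \<open>circ 7 15\<close>, and the nine members of the family form the isomorphic set.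

  The nine graphs are isomorphic.  The map \<open>\<theta>\<close> for \<open>m = 3\<close> and an even parameter \<open>2 s\<close> multiplies
  differences modulo 18 by the unit \<open>1 + 6 s\<close>, yet leaves differences divisible by 3 alone.
  Hence it moves \<open>u\<close> to any other \<open>u'\<close> and fixes \<open>w\<close> (\<open>theta_circ\<close>, \<open>type2_circ\<close>).
  Multiplication by 5 or by its inverse up to sign, 11, moves \<open>u\<close> and \<open>w\<close> simultaneously
  around two cycles of length three (\<open>type1_circ_5\<close>, \<open>type1_circ_11\<close>).  These two kinds of step
  make up every isomorphism series in the theorem.

  Nothing else is isomorphic to them (\<open>circ_classification\<close>).  Let \<open>F\<close> be an isomorphism from
  \<open>circ 1 3\<close> to a circulant graph with jump set \<open>S\<close>.  In \<open>circ 1 3\<close> two vertices have at least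
  six common neighbours iff they are congruent modulo 18.  The image of this relation is
  invariant under translations, and its classes have three elements, so they are cosets of
  the subgroup of order 3: \<open>F\<close> preserves and reflects congruence modulo 18 (\<open>F_cong_18\<close>).
  As the edges \<open>\<plusminus>1\<close> come in full cosets, so do their images, and the degree 8 leaves room for
  two full cosets only, which are opposite to each other.  The walk \<open>F 0\<close>, \<open>F 1\<close>, \<open>F 2\<close>, ... then
  never turns back modulo 18, that is \<open>F k\<close> is congruent to \<open>F 0 + k u\<close> with a constant
  \<open>u\<close> (\<open>F_arith\<close>).  Surjectivity makes \<open>u\<close> a unit, and the remaining jump
  \<open>w = F 3 - F 0\<close> is congruent to \<open>3 u\<close> modulo 18, hence to \<open>\<plusminus>3\<close>.

  For the negative statements, a multiplier \<open>x\<close> from \<open>circ u w\<close> to \<open>circ u' w'\<close> would satisfy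
  both \<open>x u = \<plusminus>u'\<close> modulo 18 and \<open>x w = \<plusminus>w'\<close> modulo 54 (\<open>mult_jumps_circ\<close>), which is
  contradictory here; and a Type-2 isomorphism with respect to 3 keeps every jump divisible
  by 3 (\<open>type2_iso_preserves_multiples\<close>), whereas this jump is 3 in one graph and 15 in the other.
\<close>

section \<open>Congruences\<close>

lemma cong_54_imp_18: "[x = y] (mod 54) \<Longrightarrow> [x = y] (mod 18)" for x y :: int
  using cong_dvd_modulus[of x y 54 18] by simp

lemma cong_18_iff_54:
  "[x = y] (mod 18) \<longleftrightarrow> [x = y] (mod 54) \<or> [x = y + 18] (mod 54) \<or> [x = y + 36] (mod 54)" for x y :: int
proof -
  have "(18 dvd d) \<longleftrightarrow> (54 dvd d) \<or> (54 dvd d - 18) \<or> (54 dvd d - 36)" for d :: int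
  proof
    assume "18 dvd d"
    then obtain k where d: "d = 18 * k" ..
    have dvd: "54 dvd 18 * k - 18 * j \<longleftrightarrow> 3 dvd k - j" for j :: int
      using dvd_mult_cancel_left[of 18 3 "k - j"] by (simp add: right_diff_distrib)
    have "k mod 3 = 0 \<or> k mod 3 = 1 \<or> k mod 3 = 2" by auto
    then have "3 dvd k - 0 \<or> 3 dvd k - 1 \<or> 3 dvd k - 2"
      by (auto simp: mod_eq_dvd_iff[symmetric])
    then show "54 dvd d \<or> 54 dvd d - 18 \<or> 54 dvd d - 36"
      using dvd[of 0] dvd[of 1] dvd[of 2] d by auto
  next
    assume "54 dvd d \<or> 54 dvd d - 18 \<or> 54 dvd d - 36"
    then have "54 dvd d - 18 * 0 \<or> 54 dvd d - 18 * 1 \<or> 54 dvd d - 18 * 2" by simp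
    moreover have "18 dvd d" if "54 dvd d - 18 * j" for j
      using dvd_add[of 18 "d - 18 * j" "18 * j"] dvd_trans[OF _ that, of 18] by simp
    ultimately show "18 dvd d" by blast
  qed
  from this[of "x - y"] show ?thesis
    by (simp add: cong_iff_dvd_diff algebra_simps)
qed

lemma cong_rewrite: "[a = b] (mod m) \<Longrightarrow> [d = a] (mod m) \<longleftrightarrow> [d = b] (mod m)" for a b d m :: int
  by (metis cong_sym cong_trans)

lemma cong_pm_rewrite:
  fixes d x y m :: int
  assumes "[x = y] (mod m) \<or> [x = - y] (mod m)"
  shows "[d = x] (mod m) \<or> [d = - x] (mod m) \<longleftrightarrow> [d = y] (mod m) \<or> [d = - y] (mod m)"
  using assms
proof
  assume xy: "[x = y] (mod m)"
  then have "[- x = - y] (mod m)" by (simp only: cong_minus_minus_iff)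
  from cong_rewrite[OF xy] cong_rewrite[OF this] show ?thesis by blast
next
  assume xy: "[x = - y] (mod m)"
  then have "[- x = - (- y)] (mod m)" by (simp only: cong_minus_minus_iff)
  from cong_rewrite[OF xy] cong_rewrite[OF this] show ?thesis by auto
qed

lemma cong_imp_dvd_iff: "[a = b] (mod m) \<Longrightarrow> k dvd m \<Longrightarrow> k dvd a \<longleftrightarrow> k dvd b" for a b k m :: int
  using cong_dvd_modulus cong_dvd_iff by blast

lemma coprime_18: "v \<in> {1, 5, 7} \<Longrightarrow> coprime v 18" for v :: int
proof -
  have "\<forall>v\<in>{1, 5, 7}. coprime v (18::int)" by code_simp
  then show "v \<in> {1, 5, 7} \<Longrightarrow> coprime v 18" by blast
qed

lemma cong_54_cancel:
  fixes x v e :: int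
  assumes "[x * (3 * v) = e * (3 * v)] (mod 54)" "coprime v 18"
  shows "[x = e] (mod 18)"
proof -
  have "3 * 18 dvd 3 * ((x - e) * v)"
    using assms(1) by (simp add: cong_iff_dvd_diff algebra_simps)
  then have "18 dvd (x - e) * v"
    by (simp only: dvd_mult_cancel_left) simp
  with assms(2) show ?thesis
    by (simp add: cong_iff_dvd_diff coprime_dvd_mult_left_iff coprime_commute)
qed

lemma cong_pm_trans:
  fixes x y z m :: int
  assumes "[x = y] (mod m) \<or> [x = - y] (mod m)" "[x = z] (mod m) \<or> [x = - z] (mod m)"
  shows "[y = z] (mod m) \<or> [y = - z] (mod m)"
  using cong_pm_rewrite[OF assms(1), of y] cong_pm_rewrite[OF assms(2), of y] by simp

section \<open>Adjacency in terms of differences\<close>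

text \<open>Adjacency only depends on the difference of the indices, so all arguments take place in the
  integers, with \<open>jump n R\<close> the periodic and symmetric set of differences generated by \<open>R\<close>.\<close>

definition jump :: "nat \<Rightarrow> nat set \<Rightarrow> int \<Rightarrow> bool" where
  "jump n R d \<longleftrightarrow> (\<exists>r\<in>R. [d = int r] (mod int n) \<or> [d = - int r] (mod int n))"

lemma jump_cong:
  assumes "[d = d'] (mod int n)"
  shows "jump n R d \<longleftrightarrow> jump n R d'"
  using assms unfolding jump_def by (metis cong_sym cong_trans)

lemma jump_minus [simp]: "jump n R (- d) \<longleftrightarrow> jump n R d"
  unfolding jump_def using cong_minus_minus_iff[of d] by (metis minus_minus cong_minus_minus_iff)

declare circulant_graph.simps [simp del]

lemma verts_circulant_graph [simp]: "verts (circulant_graph (n, R)) = {0..<n}"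
  by (simp add: verts_def circulant_graph.simps)

lemma verts_map_graph [simp]: "verts (map_graph f G) = f ` verts G"
  and edges_map_graph [simp]: "edges (map_graph f G) = (`) f ` edges G"
  by (simp_all add: map_graph_def verts_def edges_def)

lemma ugraph_eqI: "verts G = verts H \<Longrightarrow> edges G = edges H \<Longrightarrow> G = H"
  by (simp add: verts_def edges_def prod_eq_iff)

text \<open>The link between the graphs and the integers; it also covers \<open>a = b\<close>, a loop occurring
  iff a jump is divisible by \<open>n\<close>.\<close>

lemma edge_iff_jump:
  assumes "a < n" "b < n"
  shows "{a, b} \<in> edges (circulant_graph (n, R)) \<longleftrightarrow> jump n R (int b - int a)"
proof -
  have step: "y = (x + r) mod n \<longleftrightarrow> [int y - int x = int r] (mod int n)"
    if "x < n" "y < n" for x y r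
  proof -
    have "y = (x + r) mod n \<longleftrightarrow> [y = x + r] (mod n)"
      using that by (simp add: cong_def)
    also have "\<dots> \<longleftrightarrow> [int y = int (x + r)] (mod int n)"
      by (simp only: cong_int_iff)
    also have "\<dots> \<longleftrightarrow> [int y - int x = int r] (mod int n)"
      by (simp add: cong_iff_dvd_diff algebra_simps)
    finally show ?thesis .
  qed
  have neg: "[int a - int b = int r] (mod int n) \<longleftrightarrow> [int b - int a = - int r] (mod int n)" for r
    using cong_minus_minus_iff[of "int a - int b" "int r" "int n"] by simp
  have "{a, b} \<in> edges (circulant_graph (n, R)) \<longleftrightarrow>
      (\<exists>r\<in>R. b = (a + r) mod n \<or> a = (b + r) mod n)"
    using assms by (auto simp: edges_def circulant_graph.simps doubleton_eq_iff)
  then show ?thesis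
    unfolding jump_def using step[of a b] step[of b a] assms neg by simp
qed

lemma edge_obtain:
  assumes "e \<in> edges (circulant_graph (n, R))"
  obtains a b where "a < n" "b < n" "e = {a, b}"
proof -
  from assms obtain i r where "i < n" "e = {i, (i + r) mod n}"
    by (auto simp: edges_def circulant_graph.simps)
  then show thesis using that[of i "(i + r) mod n"] by simp
qed

text \<open>From right to left the bound \<open>2 r \<le> n\<close> matters: two jumps \<open>r\<close> and \<open>s\<close> that are opposite modulo
  \<open>n\<close> have sum at least \<open>n\<close>, so both equal \<open>n / 2\<close>.\<close>

lemma mem_iff_jump:
  assumes R: "is_circulant (n, R)"
  shows "r \<in> R \<longleftrightarrow> 1 \<le> r \<and> 2 * r \<le> n \<and> jump n R (int r)"
proof
  assume "r \<in> R"
  then show "1 \<le> r \<and> 2 * r \<le> n \<and> jump n R (int r)"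
    using R by (auto simp: is_circulant_def jump_def intro!: bexI[of _ r])
next
  assume *: "1 \<le> r \<and> 2 * r \<le> n \<and> jump n R (int r)"
  then obtain s where s: "s \<in> R" "[int r = int s] (mod int n) \<or> [int r = - int s] (mod int n)"
    by (auto simp: jump_def)
  with R have s_le: "1 \<le> s" "2 * s \<le> n" by (auto simp: is_circulant_def)
  from s(2) have "r = s"
  proof
    assume "[int r = int s] (mod int n)"
    with s_le * show "r = s" unfolding cong_int_iff by (simp add: cong_def)
  next
    assume "[int r = - int s] (mod int n)"
    then have "int n dvd int (r + s)" by (simp add: cong_iff_dvd_diff)
    then have "n dvd r + s" by (simp only: of_nat_dvd_iff)
    then have "n \<le> r + s" using * by (intro dvd_imp_le) simp_all
    with s_le * show "r = s" by simp
  qed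
  with s show "r \<in> R" by simp
qed

lemma jumps_eq_of_jump:
  assumes "is_circulant (n, R)" "is_circulant (n, S)" "\<And>d. jump n R d \<longleftrightarrow> jump n S d"
  shows "R = S"
  using mem_iff_jump[OF assms(1)] mem_iff_jump[OF assms(2)] assms(3) by blast

lemma map_circulant_graph:
  assumes bij: "bij_betw f {0..<n} {0..<n}"
    and adj: "\<And>i j. i < n \<Longrightarrow> j < n \<Longrightarrow>
      jump n R (int j - int i) \<longleftrightarrow> jump n S (int (f j) - int (f i))"
  shows "map_graph f (circulant_graph (n, R)) = circulant_graph (n, S)"
proof -
  have f_less: "f i < n" if "i < n" for i
    using bij_betwE[OF bij] that by auto
  have "(`) f ` edges (circulant_graph (n, R)) = edges (circulant_graph (n, S))"
  proof (intro equalityI subsetI)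
    fix e assume "e \<in> (`) f ` edges (circulant_graph (n, R))"
    then obtain d where d: "d \<in> edges (circulant_graph (n, R))" "e = f ` d" by blast
    from d(1) obtain a b where "a < n" "b < n" "d = {a, b}" by (rule edge_obtain)
    with d show "e \<in> edges (circulant_graph (n, S))"
      by (simp add: edge_iff_jump adj f_less)
  next
    fix e assume e: "e \<in> edges (circulant_graph (n, S))"
    then obtain a' b' where "a' < n" "b' < n" and e': "e = {a', b'}" by (rule edge_obtain)
    moreover from this have "a' \<in> f ` {0..<n}" "b' \<in> f ` {0..<n}"
      by (simp_all add: bij_betw_imp_surj_on[OF bij])
    ultimately obtain a b where ab: "a < n" "b < n" and f: "a' = f a" "b' = f b" by auto
    with e e' have "{a, b} \<in> edges (circulant_graph (n, R))"
      by (simp add: edge_iff_jump adj f_less)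
    moreover have "e = f ` {a, b}" using e' f by simp
    ultimately show "e \<in> (`) f ` edges (circulant_graph (n, R))" by blast
  qed
  moreover have "f ` {0..<n} = {0..<n}" by (rule bij_betw_imp_surj_on[OF bij])
  ultimately show ?thesis
    by (intro ugraph_eqI) simp_all
qed

lemma map_graph_imp_isomorphic:
  assumes bij: "bij_betw f {0..<n} {0..<n}"
    and map: "map_graph f (circulant_graph (n, R)) = circulant_graph (n, S)"
  shows "isomorphic (n, R) (n, S)"
proof -
  have "{u, v} \<in> edges (circulant_graph (n, R)) \<longleftrightarrow> {f u, f v} \<in> edges (circulant_graph (n, S))"
    if uv: "u < n" "v < n" for u v
  proof
    show "{f u, f v} \<in> edges (circulant_graph (n, S))" if "{u, v} \<in> edges (circulant_graph (n, R))"
      using imageI[OF that, of "(`) f"] unfolding map[symmetric] by simp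
  next
    assume "{f u, f v} \<in> edges (circulant_graph (n, S))"
    then obtain e where e: "e \<in> edges (circulant_graph (n, R))" "f ` {u, v} = f ` e"
      unfolding map[symmetric] by auto
    have "e \<subseteq> {0..<n}" using e(1) by (auto elim: edge_obtain)
    with e(2) uv have "{u, v} = e"
      using inj_on_image_eq_iff[OF bij_betw_imp_inj_on[OF bij], of "{u, v}" e] by auto
    with e show "{u, v} \<in> edges (circulant_graph (n, R))" by simp
  qed
  with bij show ?thesis
    by (auto simp: isomorphic_def graph_isomorphic_def intro!: exI[of _ f])
qed

lemma graph_isomorphic_sym:
  assumes "graph_isomorphic G H" shows "graph_isomorphic H G"
proof -
  from assms obtain f where bij: "bij_betw f (verts G) (verts H)"
    and f: "\<And>u v. u \<in> verts G \<Longrightarrow> v \<in> verts G \<Longrightarrow> {u, v} \<in> edges G \<longleftrightarrow> {f u, f v} \<in> edges H"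
    by (auto simp: graph_isomorphic_def)
  let ?g = "inv_into (verts G) f"
  have "?g u \<in> verts G" "f (?g u) = u" if "u \<in> verts H" for u
    using bij that by (auto simp: bij_betw_def inv_into_into f_inv_into_f)
  then show ?thesis
    unfolding graph_isomorphic_def using bij_betw_inv_into[OF bij] f by (intro exI[of _ ?g]) simp
qed

lemma graph_isomorphic_trans:
  assumes "graph_isomorphic G H" "graph_isomorphic H K" shows "graph_isomorphic G K"
proof -
  from assms obtain f g where fg: "bij_betw f (verts G) (verts H)" "bij_betw g (verts H) (verts K)"
    "\<forall>u\<in>verts G. \<forall>v\<in>verts G. {u, v} \<in> edges G \<longleftrightarrow> {f u, f v} \<in> edges H"
    "\<forall>u\<in>verts H. \<forall>v\<in>verts H. {u, v} \<in> edges H \<longleftrightarrow> {g u, g v} \<in> edges K"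
    unfolding graph_isomorphic_def by blast
  then show ?thesis
    unfolding graph_isomorphic_def using bij_betw_trans[OF fg(1,2)] bij_betwE[OF fg(1)]
    by (intro exI[of _ "g \<circ> f"]) simp
qed

lemma isomorphic_refl: "isomorphic C C"
  unfolding isomorphic_def graph_isomorphic_def by (rule exI[of _ id]) simp

lemma isomorphic_sym: "isomorphic C D \<Longrightarrow> isomorphic D C"
  unfolding isomorphic_def by (rule graph_isomorphic_sym)

lemma isomorphic_trans: "isomorphic C D \<Longrightarrow> isomorphic D E \<Longrightarrow> isomorphic C E"
  unfolding isomorphic_def by (rule graph_isomorphic_trans)

section \<open>Lifting isomorphisms to the integers\<close>

text \<open>A bijection of the residues modulo \<open>n\<close>, seen as a periodic map on the integers. In this form
  translations are isomorphisms of a circulant graph with itself without any reduction.\<close>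

definition lifted_iso :: "nat \<Rightarrow> nat set \<Rightarrow> nat set \<Rightarrow> (int \<Rightarrow> int) \<Rightarrow> bool" where
  "lifted_iso n R S F \<longleftrightarrow>
     (\<forall>x y. [F x = F y] (mod int n) \<longleftrightarrow> [x = y] (mod int n)) \<and>
     (\<forall>y. \<exists>x. [F x = y] (mod int n)) \<and>
     (\<forall>x y. jump n R (y - x) \<longleftrightarrow> jump n S (F y - F x))"

lemma isomorphic_imp_lifted_iso:
  assumes iso: "isomorphic (n, R) (n', S)" and n: "0 < n"
  shows "n' = n \<and> (\<exists>F. lifted_iso n R S F)"
proof -
  from iso obtain f where bij: "bij_betw f {0..<n} {0..<n'}"
    and adj: "\<And>i j. i < n \<Longrightarrow> j < n \<Longrightarrow>
      {i, j} \<in> edges (circulant_graph (n, R)) \<longleftrightarrow> {f i, f j} \<in> edges (circulant_graph (n', S))"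
    by (auto simp: isomorphic_def graph_isomorphic_def)
  from bij_betw_same_card[OF bij] have n': "n' = n" by simp
  have f_less: "f i < n" if "i < n" for i
    using bij_betwE[OF bij] that n' by auto
  define F where "F x = int (f (nat (x mod int n)))" for x
  have res: "nat (x mod int n) < n" for x
    using n by (simp add: nat_less_iff)
  have int_res [simp]: "int (nat (x mod int n)) = x mod int n" for x
    using n by simp
  have "[F x = F y] (mod int n) \<longleftrightarrow> [x = y] (mod int n)" for x y
  proof -
    have "[F x = F y] (mod int n) \<longleftrightarrow> f (nat (x mod int n)) = f (nat (y mod int n))"
      using f_less[OF res] unfolding F_def by (simp add: cong_int_iff cong_def)
    also have "\<dots> \<longleftrightarrow> nat (x mod int n) = nat (y mod int n)"
      using inj_on_eq_iff[OF bij_betw_imp_inj_on[OF bij]] res by simp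
    also have "\<dots> \<longleftrightarrow> [x = y] (mod int n)"
      using n by (simp add: cong_def nat_eq_iff)
    finally show ?thesis .
  qed
  moreover have "\<exists>x. [F x = y] (mod int n)" for y
  proof -
    obtain i where "i < n" "f i = nat (y mod int n)"
      using bij_betw_imp_surj_on[OF bij] n' res[of y]
      by (metis atLeastLessThan_iff imageE zero_le)
    then show ?thesis by (intro exI[of _ "int i"]) (simp add: F_def cong_def)
  qed
  moreover have "jump n R (y - x) \<longleftrightarrow> jump n S (F y - F x)" for x y
  proof -
    have "jump n R (y - x) \<longleftrightarrow> jump n R (int (nat (y mod int n)) - int (nat (x mod int n)))"
      unfolding int_res by (rule jump_cong) (simp add: cong_def mod_diff_eq)
    also have "\<dots> \<longleftrightarrow> jump n S (F y - F x)"
      using adj[OF res res] unfolding F_def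
      by (simp add: edge_iff_jump res f_less n')
    finally show ?thesis .
  qed
  ultimately show ?thesis using n' unfolding lifted_iso_def by blast
qed

section \<open>Common neighbours\<close>

definition common :: "nat \<Rightarrow> nat set \<Rightarrow> int \<Rightarrow> int \<Rightarrow> nat" where
  "common n R x y = card {z \<in> {0..<int n}. jump n R (z - x) \<and> jump n R (z - y)}"

lemma common_lifted_iso:
  assumes F: "lifted_iso n R S F" and n: "0 < n"
  shows "common n S (F x) (F y) = common n R x y"
proof -
  have cong: "[F x = F y] (mod int n) \<longleftrightarrow> [x = y] (mod int n)" for x y
    using F by (simp add: lifted_iso_def)
  have adj: "jump n S (F z mod int n - F x) \<longleftrightarrow> jump n R (z - x)" for x z
  proof -
    have "jump n S (F z mod int n - F x) \<longleftrightarrow> jump n S (F z - F x)"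
      by (rule jump_cong) (simp add: cong_def mod_diff_left_eq)
    then show ?thesis using F by (simp add: lifted_iso_def)
  qed
  have "bij_betw (\<lambda>z. F z mod int n) {z \<in> {0..<int n}. jump n R (z - x) \<and> jump n R (z - y)}
     {z \<in> {0..<int n}. jump n S (z - F x) \<and> jump n S (z - F y)}"
  proof (rule bij_betw_imageI)
    show "inj_on (\<lambda>z. F z mod int n) {z \<in> {0..<int n}. jump n R (z - x) \<and> jump n R (z - y)}"
    proof (rule inj_onI)
      fix a b assume ab: "a \<in> {z \<in> {0..<int n}. jump n R (z - x) \<and> jump n R (z - y)}"
        "b \<in> {z \<in> {0..<int n}. jump n R (z - x) \<and> jump n R (z - y)}" "F a mod int n = F b mod int n"
      then show "a = b" using cong[of a b] by (simp add: cong_def)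
    qed
    show "(\<lambda>z. F z mod int n) ` {z \<in> {0..<int n}. jump n R (z - x) \<and> jump n R (z - y)} =
       {z \<in> {0..<int n}. jump n S (z - F x) \<and> jump n S (z - F y)}"
    proof (intro equalityI subsetI)
      fix z assume z: "z \<in> {z \<in> {0..<int n}. jump n S (z - F x) \<and> jump n S (z - F y)}"
      obtain c where "[F c = z] (mod int n)" using F unfolding lifted_iso_def by blast
      then have c: "[F (c mod int n) = z] (mod int n)"
        using cong[of "c mod int n" c] by (simp add: cong_def)
      with z have "F (c mod int n) mod int n = z" by (simp add: cong_def)
      with z adj[of "c mod int n"] n
      show "z \<in> (\<lambda>z. F z mod int n) ` {z \<in> {0..<int n}. jump n R (z - x) \<and> jump n R (z - y)}"
        by (auto intro!: image_eqI[of _ _ "c mod int n"])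
    qed (use n adj in auto)
  qed
  then show ?thesis unfolding common_def by (simp add: bij_betw_same_card)
qed

lemma common_translate:
  assumes "0 < n" shows "common n R (x + c) (y + c) = common n R x y"
proof (rule common_lifted_iso[where F = "\<lambda>x. x + c"])
  show "lifted_iso n R R (\<lambda>x. x + c)"
    unfolding lifted_iso_def
  proof (intro conjI allI)
    show "\<exists>x. [x + c = y] (mod int n)" for y by (rule exI[of _ "y - c"]) simp
  qed (simp_all add: cong_add_rcancel)
qed fact

text \<open>By translation invariance the count depends on \<open>y - x\<close> alone; as the length of a filtered list
  it can be evaluated.\<close>

lemma common_eq_length_filter:
  assumes n: "0 < n" and jump: "\<And>d. jump n R d \<longleftrightarrow> d mod int n \<in> set L"
    and L: "distinct L" "set L \<subseteq> {0..<int n}"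
  shows "common n R x y = length (filter (\<lambda>z. (z - (y - x) mod int n) mod int n \<in> set L) L)"
proof -
  have "common n R x y = common n R 0 (y - x)"
    using common_translate[OF n, of R 0 x "y - x"] by simp
  also have "{z \<in> {0..<int n}. jump n R (z - 0) \<and> jump n R (z - (y - x))} =
      set (filter (\<lambda>z. (z - (y - x) mod int n) mod int n \<in> set L) L)"
    using L(2) by (auto simp: jump mod_diff_right_eq)
  then have "common n R 0 (y - x) = card (set (filter (\<lambda>z. (z - (y - x) mod int n) mod int n \<in> set L) L))"
    unfolding common_def by simp
  also have "\<dots> = length (filter (\<lambda>z. (z - (y - x) mod int n) mod int n \<in> set L) L)"
    by (intro distinct_card distinct_filter L(1))
  finally show ?thesis .
qed

lemma jump_1_3_17_19:
  "jump 54 {1, 3, 17, 19} d \<longleftrightarrow> d mod 54 \<in> set [1, 3, 17, 19, 35, 37, 51, 53]"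
  by (simp add: jump_def cong_def disj_ac)

lemma common_1_3_17_19:
  "common 54 {1, 3, 17, 19} x y =
     length (filter (\<lambda>z. (z - (y - x) mod 54) mod 54 \<in> set [1, 3, 17, 19, 35, 37, 51, 53])
       [1, 3, 17, 19, 35, 37, 51, 53])"
proof (rule common_eq_length_filter[of 54, unfolded of_nat_numeral])
  show "jump 54 {1, 3, 17, 19} d \<longleftrightarrow> d mod 54 \<in> set [1, 3, 17, 19, 35, 37, 51, 53]" for d
    by (rule jump_1_3_17_19)
qed simp_all

lemma common_1_3_17_19_self: "common 54 {1, 3, 17, 19} x x = 8"
  unfolding common_1_3_17_19 by simp

text \<open>The jump residues are the cosets of \<open>18\<int>\<close> through 1 and -1, and \<open>\<plusminus>3\<close>. Each coset is
  invariant under addition of 18, which gives six common neighbours at distance 18 or 36.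
  The next largest count is five, for the differences \<open>\<plusminus>2\<close> modulo 18.\<close>

lemma common_1_3_17_19_ge_6_iff:
  "6 \<le> common 54 {1, 3, 17, 19} x y \<longleftrightarrow> [x = y] (mod 18)"
proof -
  have table: "\<forall>d\<in>set [0..53]. 6 \<le> length (filter (\<lambda>z. (z - d) mod 54 \<in> set [1, 3, 17, 19, 35, 37, 51, 53])
       [1, 3, 17, 19, 35, 37, 51, 53]) \<longleftrightarrow> d mod 18 = (0::int)"
    by code_simp
  have "(y - x) mod 54 \<in> set [0..53]"
    unfolding set_upto by simp
  from bspec[OF table this] have "6 \<le> common 54 {1, 3, 17, 19} x y \<longleftrightarrow> (y - x) mod 54 mod 18 = 0"
    unfolding common_1_3_17_19 .
  also have "\<dots> \<longleftrightarrow> [x = y] (mod 18)"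
    by (simp add: mod_mod_cancel cong_iff_dvd_diff dvd_eq_mod_eq_0[symmetric] dvd_diff_commute)
  finally show ?thesis .
qed

section \<open>Rigidity of the isomorphisms\<close>

definition full :: "nat set \<Rightarrow> int \<Rightarrow> bool" where
  "full S v \<longleftrightarrow> (\<forall>d. [d = v] (mod 18) \<longrightarrow> jump 54 S d)"

lemma full_minus: "full S v \<Longrightarrow> full S (- v)"
  unfolding full_def by (metis jump_minus cong_minus_minus_iff minus_minus)

definition coset :: "int \<Rightarrow> int set" where
  "coset v = {z \<in> {0..<54}. [z = v] (mod 18)}"

lemma coset_eq: "coset v = {v mod 18, v mod 18 + 18, v mod 18 + 36}"
proof -
  have "0 \<le> z \<and> z < 54 \<and> z mod 18 = m \<longleftrightarrow> z = m \<or> z = m + 18 \<or> z = m + 36"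
    if "0 \<le> m" "m < 18" for z m :: int
  proof
    assume z: "0 \<le> z \<and> z < 54 \<and> z mod 18 = m"
    then have "0 \<le> z div 18" "z div 18 < 3" by auto
    then have "z div 18 = 0 \<or> z div 18 = 1 \<or> z div 18 = 2" by linarith
    moreover have "z = 18 * (z div 18) + m" using z mult_div_mod_eq[of 18 z] by simp
    ultimately show "z = m \<or> z = m + 18 \<or> z = m + 36" by linarith
  next
    assume "z = m \<or> z = m + 18 \<or> z = m + 36"
    then show "0 \<le> z \<and> z < 54 \<and> z mod 18 = m"
      using that mod_mult_self2[of m 18 1] mod_mult_self2[of m 18 2] by (auto simp del: mod_mult_self2)
  qed
  from this[of "v mod 18"] show ?thesis
    unfolding coset_def cong_def by auto
qed

lemma finite_coset: "finite (coset v)"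
  by (simp add: coset_eq)

lemma card_coset: "card (coset v) = 3"
  by (simp add: coset_eq)

locale lifted_iso_1_3_17_19 =
  fixes S :: "nat set" and F :: "int \<Rightarrow> int"
  assumes lifted: "lifted_iso 54 {1, 3, 17, 19} S F"
begin

lemma F_cong: "[F x = F y] (mod 54) \<longleftrightarrow> [x = y] (mod 54)"
  using lifted unfolding lifted_iso_def by simp

lemma F_surj: obtains x where "[F x = y] (mod 54)"
  using lifted unfolding lifted_iso_def of_nat_numeral by blast

lemma F_jump: "jump 54 S (F y - F x) \<longleftrightarrow> jump 54 {1, 3, 17, 19} (y - x)"
  using lifted unfolding lifted_iso_def by simp

lemma common_F: "6 \<le> common 54 S (F x) (F y) \<longleftrightarrow> [x = y] (mod 18)"
  using common_lifted_iso[OF lifted] common_1_3_17_19_ge_6_iff by simp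

lemma common_cong:
  assumes "[a = a'] (mod 54)" "[b = b'] (mod 54)"
  shows "common 54 S a b = common 54 S a' b'"
proof -
  have "[z - a = z - a'] (mod int 54)" "[z - b = z - b'] (mod int 54)" for z
    using assms by (auto intro: cong_diff)
  then show ?thesis unfolding common_def using jump_cong[of _ _ 54 S] by metis
qed

lemma common_iff:
  assumes "[F x = a] (mod 54)" "[F y = b] (mod 54)"
  shows "6 \<le> common 54 S a b \<longleftrightarrow> [x = y] (mod 18)"
  unfolding common_F[symmetric] common_cong[OF assms] ..

text \<open>Transitivity is a property of the first graph, where the relation is congruence modulo 18;
  \<open>F\<close> carries it over.\<close>

lemma common_trans:
  assumes "6 \<le> common 54 S a b" "6 \<le> common 54 S b c"
  shows "6 \<le> common 54 S a c"
proof -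
  obtain x y z where xyz: "[F x = a] (mod 54)" "[F y = b] (mod 54)" "[F z = c] (mod 54)"
    by (metis F_surj)
  have "[x = y] (mod 18)" "[y = z] (mod 18)"
    using assms common_iff[OF xyz(1,2)] common_iff[OF xyz(2,3)] by simp_all
  then have "[x = z] (mod 18)" by (rule cong_trans)
  then show ?thesis using common_iff[OF xyz(1,3)] by simp
qed

lemma common_imp_cong:
  assumes "6 \<le> common 54 S (F a) y"
  shows "\<exists>c\<in>{a, a + 18, a + 36}. [F c = y] (mod 54)"
proof -
  obtain x where x: "[F x = y] (mod 54)" by (rule F_surj)
  have "[x = a] (mod 18)"
    using assms common_iff[OF cong_refl x] by (simp add: cong_sym)
  then have "[x = a] (mod 54) \<or> [x = a + 18] (mod 54) \<or> [x = a + 36] (mod 54)"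
    by (simp only: cong_18_iff_54)
  then show ?thesis using x F_cong cong_trans cong_sym by (metis insert_iff)
qed

text \<open>The class of \<open>F a\<close> is \<open>{F a, F a + d, F a + e}\<close>. Translation invariance and transitivity make
  \<open>{0, d, e}\<close> closed under adding \<open>d\<close> modulo 54. Hence it is the subgroup of order 3, and \<open>d\<close> and
  \<open>e\<close> are 18 and 36 in some order.\<close>

lemma F_shift_18: "[F (a + 18) = F a + 18] (mod 54) \<and> [F (a + 36) = F a + 36] (mod 54) \<or>
  [F (a + 18) = F a + 36] (mod 54) \<and> [F (a + 36) = F a + 18] (mod 54)"
proof -
  define d e where de: "d = F (a + 18) - F a" "e = F (a + 36) - F a"
  have d: "6 \<le> common 54 S (F a) (F a + d)" and e: "6 \<le> common 54 S (F a) (F a + e)"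
    unfolding de using common_F by (simp_all add: cong_iff_dvd_diff)
  have cl: "[F a + x + d = F a] (mod 54) \<or> [F a + x + d = F a + d] (mod 54) \<or> [F a + x + d = F a + e] (mod 54)"
    if "6 \<le> common 54 S (F a) (F a + x)" for x
  proof -
    have "6 \<le> common 54 S (F a + d) (F a + x + d)"
      using that common_translate[of 54 S "F a" d "F a + x"] by simp
    with d have "6 \<le> common 54 S (F a) (F a + x + d)" by (rule common_trans)
    from common_imp_cong[OF this] show ?thesis unfolding de by (auto intro: cong_sym)
  qed
  have distinct: "\<not> [d = 0] (mod 54)" "\<not> [e = 0] (mod 54)" "\<not> [d = e] (mod 54)"
    using F_cong[of "a + 18" a] F_cong[of "a + 36" a] F_cong[of "a + 18" "a + 36"]
    unfolding de by (simp_all add: cong_iff_dvd_diff)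
  have "[d + d = 0] (mod 54) \<or> [d + d = d] (mod 54) \<or> [d + d = e] (mod 54)"
    using cl[OF d] by (simp add: cong_iff_dvd_diff)
  moreover have "[e + d = 0] (mod 54) \<or> [e + d = d] (mod 54) \<or> [e + d = e] (mod 54)"
    using cl[OF e] by (simp add: cong_iff_dvd_diff)
  ultimately have ed: "[e + d = 0] (mod 54)" and *: "[d + d = 0] (mod 54) \<or> [d + d = e] (mod 54)"
    using distinct by (auto simp: cong_iff_dvd_diff)
  have "\<not> [d + d = 0] (mod 54)"
  proof
    assume "[d + d = 0] (mod 54)"
    from cong_trans[OF this cong_sym[OF ed]] distinct(3) show False by (simp add: cong_iff_dvd_diff)
  qed
  with * have dd: "[d + d = e] (mod 54)" by simp
  have "[d + d + d = e + d] (mod 54)"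
    using dd cong_refl by (rule cong_add)
  from this ed have "[d + d + d = 0] (mod 54)" by (rule cong_trans)
  then have "54 dvd 3 * d"
    by (simp add: cong_iff_dvd_diff)
  then have "18 dvd d"
    using dvd_mult_cancel_left[of 3 18 d] by simp
  then have "[d = 0] (mod 18)" by (simp add: cong_0_iff)
  then have d: "[d = 18] (mod 54) \<or> [d = 36] (mod 54)"
    using distinct(1) by (simp add: cong_18_iff_54)
  have "[e = 36] (mod 54)" if "[d = 18] (mod 54)"
    using cong_trans[OF cong_sym[OF dd] cong_add[OF that that]] by simp
  moreover have "[e = 18] (mod 54)" if "[d = 36] (mod 54)"
    using cong_trans[OF cong_sym[OF dd] cong_add[OF that that]] by (simp add: cong_def)
  ultimately have "[d = 18] (mod 54) \<and> [e = 36] (mod 54) \<or> [d = 36] (mod 54) \<and> [e = 18] (mod 54)"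
    using d by blast
  then show ?thesis unfolding de by (simp add: cong_iff_dvd_diff algebra_simps)
qed

lemma F_cong_18: "[F x = F y] (mod 18) \<longleftrightarrow> [x = y] (mod 18)"
proof -
  have "[F x = F y] (mod 18) \<longleftrightarrow>
      [F x = F y] (mod 54) \<or> [F x = F (y + 18)] (mod 54) \<or> [F x = F (y + 36)] (mod 54)"
    unfolding cong_18_iff_54 using F_shift_18[of y] cong_trans cong_sym by blast
  also have "\<dots> \<longleftrightarrow> [x = y] (mod 18)"
    unfolding F_cong by (rule cong_18_iff_54[symmetric])
  finally show ?thesis .
qed

lemma card_jump: "card {z \<in> {0..<54}. jump 54 S z} = 8"
proof -
  have "common 54 S (F 0) (F 0) = 8"
    using common_lifted_iso[OF lifted] common_1_3_17_19_self by simp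
  then have "common 54 S 0 0 = 8"
    using common_translate[of 54 S 0 "F 0" 0] by simp
  then show ?thesis by (simp add: common_def)
qed

lemma finite_jump: "finite {z \<in> {0..<54}. jump 54 S z}"
  using card_jump card_ge_0_finite by fastforce

text \<open>The neighbours \<open>x + \<epsilon> + 18 k\<close> of \<open>x\<close> are mapped onto all vertices congruent to
  \<open>F (x + \<epsilon>)\<close> modulo 18.\<close>

lemma full_step:
  assumes "\<epsilon> \<in> {1, -1}"
  shows "full S (F (x + \<epsilon>) - F x)"
  unfolding full_def
proof (intro allI impI)
  fix d assume d: "[d = F (x + \<epsilon>) - F x] (mod 18)"
  obtain c where c: "[F c = F x + d] (mod 54)" by (rule F_surj)
  then have "[F c = F x + d] (mod 18)" by (rule cong_54_imp_18)
  moreover have "[F x + d = F (x + \<epsilon>)] (mod 18)"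
    using cong_add[OF cong_refl[of "F x"] d] by simp
  ultimately have "[F c = F (x + \<epsilon>)] (mod 18)" by (rule cong_trans)
  then have "[c = x + \<epsilon>] (mod 18)" by (simp only: F_cong_18)
  then have "[c - x = \<epsilon>] (mod 18)"
    by (simp add: cong_iff_dvd_diff algebra_simps)
  then have "(c - x) mod 18 = 1 \<or> (c - x) mod 18 = 17"
    using assms by (auto simp: cong_def)
  moreover have "e mod 54 \<in> set [1, 19, 37, 17, 35, 53]" if "e mod 18 = 1 \<or> e mod 18 = 17" for e :: int
  proof -
    from that have "[e = 1] (mod 18) \<or> [e = 17] (mod 18)" by (simp add: cong_def)
    then show ?thesis unfolding cong_18_iff_54 by (auto simp: cong_def)
  qed
  ultimately have "jump 54 S (F c - F x)"
    unfolding F_jump jump_1_3_17_19 by auto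
  moreover have "[F c - F x = d] (mod int 54)"
    using c by (simp add: cong_iff_dvd_diff algebra_simps)
  ultimately show "jump 54 S d" using jump_cong by blast
qed

text \<open>Three disjoint cosets would have nine elements, more than the degree 8.\<close>

lemma full_three:
  assumes "full S a" "full S b" "full S c"
  shows "[a = b] (mod 18) \<or> [b = c] (mod 18) \<or> [a = c] (mod 18)"
proof (rule ccontr)
  assume neq: "\<not> ?thesis"
  have disj: "coset v \<inter> coset w = {}" if "\<not> [v = w] (mod 18)" for v w
    using that unfolding coset_def by (auto dest: cong_sym cong_trans)
  have "coset a \<inter> coset b = {}" "(coset a \<union> coset b) \<inter> coset c = {}"
    using neq disj by blast+
  then have "card (coset a \<union> coset b \<union> coset c) = 9"
    by (simp add: card_Un_disjoint card_coset finite_coset)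
  moreover have "coset a \<union> coset b \<union> coset c \<subseteq> {z \<in> {0..<54}. jump 54 S z}"
    using assms unfolding coset_def full_def by auto
  then have "card (coset a \<union> coset b \<union> coset c) \<le> 8"
    unfolding card_jump[symmetric] by (intro card_mono finite_jump)
  ultimately show False by simp
qed

text \<open>The two steps from \<open>F x\<close> to \<open>F (x + 1)\<close> and \<open>F (x - 1)\<close>, and the negatives of these steps, lie
  in full cosets, of which at most two are distinct. If the first step were its own negative modulo
  18, the second would be too; both would be 9, as none is 0, although they are distinct.\<close>

lemma F_opposite: "[F (x - 1) - F x = - (F (x + 1) - F x)] (mod 18)"
  and F_not_self_opposite: "\<not> [F (x + 1) - F x = - (F (x + 1) - F x)] (mod 18)"
proof -
  let ?u = "F (x + 1) - F x" and ?v = "F (x - 1) - F x"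
  have u: "full S ?u" and v: "full S ?v"
    using full_step[of 1 x] full_step[of "-1" x] by simp_all
  have neq: "\<not> [?u = ?v] (mod 18)" "\<not> [?u = 0] (mod 18)" "\<not> [?v = 0] (mod 18)"
    using F_cong_18[of "x + 1" "x - 1"] F_cong_18[of "x + 1" x] F_cong_18[of "x - 1" x]
    by (simp_all add: cong_iff_dvd_diff)
  have u': "[?u = - ?u] (mod 18) \<or> [- ?u = ?v] (mod 18)"
    using full_three[OF u full_minus[OF u] v] neq by blast
  have v': "[?v = - ?v] (mod 18) \<or> [- ?v = ?u] (mod 18)"
    using full_three[OF v full_minus[OF v] u] neq cong_sym by blast
  have nine: "w mod 18 = 9" if "[w = - w] (mod 18)" "\<not> [w = 0] (mod 18)" for w :: int
  proof -
    from that(1) have "18 dvd 2 * w" by (simp add: cong_iff_dvd_diff)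
    then have "9 dvd w" using dvd_mult_cancel_left[of 2 9 w] by simp
    then obtain k where k: "w = 9 * k" ..
    show ?thesis
    proof (cases "even k")
      case True
      with k that(2) show ?thesis by (auto simp: cong_def elim!: evenE)
    next
      case False
      then obtain j where "k = 2 * j + 1" by (auto elim: oddE)
      with k have "w = 9 + 18 * j" by simp
      then show ?thesis by simp
    qed
  qed
  have not_self: "\<not> [?u = - ?u] (mod 18)"
  proof
    assume self: "[?u = - ?u] (mod 18)"
    from v' show False
    proof
      assume "[?v = - ?v] (mod 18)"
      from nine[OF self neq(2)] nine[OF this neq(3)] neq(1) show False by (simp add: cong_def)
    next
      assume "[- ?v = ?u] (mod 18)"
      then have "[- (- ?v) = - ?u] (mod 18)" by (simp only: cong_minus_minus_iff)
      with self neq(1) show False by (metis cong_sym cong_trans minus_minus)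
    qed
  qed
  with u' have "\<not> [?u = - ?u] (mod 18) \<and> [?v = - ?u] (mod 18)"
    by (simp add: cong_sym)
  then show "[?v = - ?u] (mod 18)" "\<not> [?u = - ?u] (mod 18)" by simp_all
qed

text \<open>A step modulo 18 equals the next one, since stepping back is the opposite of stepping on.\<close>

lemma F_arith: "[F (int k) = F 0 + int k * (F 1 - F 0)] (mod 18)"
proof -
  have step: "[F (int k + 1) - F (int k) = F 1 - F 0] (mod 18)" for k
  proof (induction k)
    case (Suc k)
    have "[F (int k + 1 + 1) - F (int k + 1) = F (int k + 1) - F (int k)] (mod 18)"
      using cong_minus_minus_iff[THEN iffD2, OF F_opposite[of "int k + 1"]] by (simp add: cong_sym)
    with Suc show ?case by (simp add: cong_trans add.commute)
  qed simp
  show ?thesis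
  proof (induction k)
    case (Suc k)
    have "[F (int k) + (F (int k + 1) - F (int k)) = F 0 + int k * (F 1 - F 0) + (F 1 - F 0)] (mod 18)"
      using Suc step by (rule cong_add)
    then show ?case by (simp add: algebra_simps)
  qed simp
qed

text \<open>Some vertex is mapped to \<open>F 0 + 1\<close>, so a multiple of the step is congruent to 1.\<close>

lemma coprime_step: "coprime (F 1 - F 0) 18"
proof -
  obtain c where c: "[F c = F 0 + 1] (mod 54)" by (rule F_surj)
  define k where "k = nat (c mod 54)"
  have "[int k = c] (mod 54)" unfolding k_def by (simp add: cong_def)
  then have "[F (int k) = F c] (mod 54)" by (simp add: F_cong)
  from this c have "[F (int k) = F 0 + 1] (mod 54)" by (rule cong_trans)
  then have "[F (int k) = F 0 + 1] (mod 18)" by (rule cong_54_imp_18)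
  with F_arith[of k] have "[F 0 + int k * (F 1 - F 0) = F 0 + 1] (mod 18)"
    using cong_sym cong_trans by blast
  then have "[(F 1 - F 0) * int k = 1] (mod 18)"
    by (simp add: cong_iff_dvd_diff mult.commute)
  then show ?thesis by (metis coprime_iff_invertible_int)
qed

text \<open>Two full cosets and the two residues \<open>\<plusminus>w\<close> are eight elements in all, which exhausts the degree.\<close>

lemma jump_iff:
  defines "u \<equiv> F 1 - F 0" and "w \<equiv> F 3 - F 0"
  shows "[w = 3 * u] (mod 18)"
    and "jump 54 S d \<longleftrightarrow> [d = u] (mod 18) \<or> [d = - u] (mod 18) \<or> [d = w] (mod 54) \<or> [d = - w] (mod 54)"
proof -
  show w: "[w = 3 * u] (mod 18)"
    using F_arith[of 3] unfolding u_def w_def by (simp add: cong_iff_dvd_diff algebra_simps)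
  have "full S u"
    using full_step[of 1 0] by (simp add: u_def)
  then have u: "full S u" "full S (- u)"
    by (simp_all add: full_minus)
  have not_self: "\<not> [u = - u] (mod 18)"
    using F_not_self_opposite[of 0] by (simp add: u_def)
  have "jump 54 S w"
    unfolding w_def F_jump jump_1_3_17_19 by simp
  then have jw: "jump 54 S (w mod 54)" "jump 54 S (- w mod 54)"
    using jump_cong[of "w mod 54" w 54 S] jump_cong[of "- w mod 54" "- w" 54 S] by simp_all
  have "\<not> [w = u] (mod 18)"
    using F_cong_18[of 3 1] by (simp add: u_def w_def cong_iff_dvd_diff)
  moreover have "\<not> [w = - u] (mod 18)"
  proof
    assume "[w = - u] (mod 18)"
    moreover have "[F (- 1) - F 0 = - u] (mod 18)"
      using F_opposite[of 0] by (simp add: u_def)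
    ultimately have "[w = F (- 1) - F 0] (mod 18)" by (metis cong_sym cong_trans)
    then show False
      using F_cong_18[of 3 "- 1"] by (simp add: w_def cong_iff_dvd_diff)
  qed
  ultimately have "\<not> [x = u] (mod 18) \<and> \<not> [x = - u] (mod 18)" if "x = w mod 54 \<or> x = - w mod 54" for x
  proof -
    from that have "[x = w] (mod 54) \<or> [x = - w] (mod 54)" by (auto simp: cong_def)
    then have "[x = w] (mod 18) \<or> [x = - w] (mod 18)" using cong_54_imp_18 by blast
    with \<open>\<not> [w = u] (mod 18)\<close> \<open>\<not> [w = - u] (mod 18)\<close> show ?thesis
      by (metis cong_minus_minus_iff cong_sym cong_trans minus_minus)
  qed
  then have disj: "(coset u \<union> coset (- u)) \<inter> {w mod 54, - w mod 54} = {}"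
    unfolding coset_def by blast
  have neq: "w mod 54 \<noteq> - w mod 54"
  proof
    assume "w mod 54 = - w mod 54"
    then have "54 dvd 2 * w" by (simp add: cong_iff_dvd_diff flip: cong_def)
    then have "27 dvd w" using dvd_mult_cancel_left[of 2 27 w] by simp
    then have "9 dvd w" using dvd_trans[of 9 27 w] by simp
    moreover have "9 dvd w - 3 * u"
      using w dvd_trans[of 9 18 "w - 3 * u"] by (simp add: cong_iff_dvd_diff)
    ultimately have "9 dvd w - (w - 3 * u)" by (rule dvd_diff)
    then have "3 dvd u" using dvd_mult_cancel_left[of 3 3 u] by simp
    then show False
      using coprime_common_divisor[OF coprime_step, of 3] unfolding u_def by simp
  qed
  have "coset u \<inter> coset (- u) = {}"
    using not_self unfolding coset_def by (auto dest: cong_sym cong_trans)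
  then have "card (coset u \<union> coset (- u) \<union> {w mod 54, - w mod 54}) = 8"
    using disj neq by (simp add: card_Un_disjoint card_coset finite_coset)
  moreover have "coset u \<union> coset (- u) \<union> {w mod 54, - w mod 54} \<subseteq> {z \<in> {0..<54}. jump 54 S z}"
    using u jw unfolding coset_def full_def by auto
  ultimately have eq: "coset u \<union> coset (- u) \<union> {w mod 54, - w mod 54} = {z \<in> {0..<54}. jump 54 S z}"
    by (intro card_subset_eq finite_jump) (simp_all only: card_jump)
  have "jump 54 S d \<longleftrightarrow> jump 54 S (d mod 54)"
    by (rule jump_cong) (simp add: cong_def)
  also have "\<dots> \<longleftrightarrow> d mod 54 \<in> {z \<in> {0..<54}. jump 54 S z}"
    by simp
  also have "\<dots> \<longleftrightarrow> [d mod 54 = u] (mod 18) \<or> [d mod 54 = - u] (mod 18) \<or>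
      d mod 54 = w mod 54 \<or> d mod 54 = - w mod 54"
    unfolding eq[symmetric] coset_def by auto
  also have "\<dots> \<longleftrightarrow> [d = u] (mod 18) \<or> [d = - u] (mod 18) \<or> [d = w] (mod 54) \<or> [d = - w] (mod 54)"
    by (simp add: cong_def mod_mod_cancel)
  finally show "jump 54 S d \<longleftrightarrow> \<dots>" .
qed

end

section \<open>The family of nine graphs\<close>

definition circ :: "nat \<Rightarrow> nat \<Rightarrow> circulant" where
  "circ u w = (54, {u, 18 - u, 18 + u, w})"

text \<open>Up to sign and modulo 54, the jumps \<open>u\<close>, \<open>18 - u\<close> and \<open>18 + u\<close> are the representatives
  \<open>u\<close>, \<open>u + 36\<close> and \<open>u + 18\<close> of one coset of \<open>18\<int>\<close>.\<close>

lemma jump_circ: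
  assumes "u \<le> 18"
  shows "jump 54 {u, 18 - u, 18 + u, w} d \<longleftrightarrow>
    [d = int u] (mod 18) \<or> [d = - int u] (mod 18) \<or> [d = int w] (mod 54) \<or> [d = - int w] (mod 54)"
proof -
  have wrap: "[d = - (18 - int u)] (mod 54) \<longleftrightarrow> [d = int u + 36] (mod 54)"
    "[d = - (18 + int u)] (mod 54) \<longleftrightarrow> [d = - int u + 36] (mod 54)"
    using cong_rewrite[of "- (18 - int u)" "int u + 36" 54 d]
      cong_rewrite[of "- (18 + int u)" "- int u + 36" 54 d]
    by (simp_all add: cong_iff_dvd_diff)
  have "jump 54 {u, 18 - u, 18 + u, w} d \<longleftrightarrow>
      ([d = int u] (mod 54) \<or> [d = - int u] (mod 54)) \<or>
      ([d = 18 - int u] (mod 54) \<or> [d = - (18 - int u)] (mod 54)) \<or>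
      ([d = 18 + int u] (mod 54) \<or> [d = - (18 + int u)] (mod 54)) \<or>
      ([d = int w] (mod 54) \<or> [d = - int w] (mod 54))"
    using assms unfolding jump_def by (simp only: bex_simps simp_thms of_nat_diff of_nat_add of_nat_numeral)
  then show ?thesis
    unfolding wrap cong_18_iff_54[of d "int u"] cong_18_iff_54[of d "- int u"]
    by (simp only: add.commute[of 18] diff_conv_add_uminus) blast
qed

lemma is_circulant_circ:
  "u \<in> {1, 5, 7} \<Longrightarrow> w \<in> {3, 15, 21} \<Longrightarrow> is_circulant (circ u w)"
  by (auto simp: is_circulant_def circ_def)

text \<open>Up to sign, the units modulo 18 are 1, 5 and 7, and the residues modulo 54 that are congruent
  to \<open>\<plusminus>3\<close> modulo 18 are 3, 15 and 21. The factor 3 turns every unit \<open>u\<close> into \<open>3 u = \<plusminus>3\<close>.\<close>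

lemma circ_classification:
  assumes circulant: "is_circulant (n, S)" and iso: "isomorphic (circ 1 3) (n, S)"
  shows "\<exists>u\<in>{1, 5, 7}. \<exists>w\<in>{3, 15, 21}. (n, S) = circ u w"
proof -
  have "circ 1 3 = (54, {1, 3, 17, 19})" by (auto simp: circ_def)
  with iso have "isomorphic (54, {1, 3, 17, 19}) (n, S)" by simp
  from isomorphic_imp_lifted_iso[OF this] obtain F
    where n: "n = 54" and F: "lifted_iso 54 {1, 3, 17, 19} S F" by auto
  interpret lifted_iso_1_3_17_19 S F by standard (rule F)
  define u w where "u = F 1 - F 0" and "w = F 3 - F 0"
  have w: "[w = 3 * u] (mod 18)"
    and jump: "jump 54 S d \<longleftrightarrow> [d = u] (mod 18) \<or> [d = - u] (mod 18) \<or> [d = w] (mod 54) \<or> [d = - w] (mod 54)" for d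
    using jump_iff unfolding u_def w_def by blast+
  have "\<not> 2 dvd u" "\<not> 3 dvd u"
    using coprime_step coprime_common_divisor[of u 18 2] coprime_common_divisor[of u 18 3]
    unfolding u_def by auto
  then have "\<not> 2 dvd u mod 18" "\<not> 3 dvd u mod 18"
    by (simp_all add: dvd_mod_iff)
  moreover have "u mod 18 \<in> set [0..17]"
    by simp
  moreover have "\<forall>r\<in>set [0..17]. \<not> 2 dvd r \<longrightarrow> \<not> 3 dvd r \<longrightarrow> r \<in> {1, 5, 7, 11, 13, 17 :: int}"
    by code_simp
  ultimately have u_mod: "u mod 18 \<in> {1, 5, 7, 11, 13, 17}"
    by blast
  then have "\<exists>u0\<in>{1, 5, 7}. [u = u0] (mod 18) \<or> [u = - u0] (mod 18)"
    by (auto simp: cong_def)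
  then obtain u0 :: int where u0: "u0 \<in> {1, 5, 7}" "[u = u0] (mod 18) \<or> [u = - u0] (mod 18)"
    by blast
  have "[3 * u = 3] (mod 18) \<or> [3 * u = - 3] (mod 18)"
  proof -
    have "3 * (u mod 18) mod 18 = 3 \<or> 3 * (u mod 18) mod 18 = 15"
      using u_mod by (elim insertE emptyE) simp_all
    then show ?thesis by (simp add: cong_def mod_mult_right_eq)
  qed
  with w have "[w = 3] (mod 18) \<or> [w = - 3] (mod 18)"
    using cong_trans by blast
  then have "\<exists>w0\<in>{3, 15, 21}. [w = w0] (mod 54) \<or> [w = - w0] (mod 54)"
    unfolding cong_18_iff_54 by (auto simp: cong_def)
  then obtain w0 :: int where w0: "w0 \<in> {3, 15, 21}" "[w = w0] (mod 54) \<or> [w = - w0] (mod 54)"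
    by blast
  define u' w' where "u' = nat u0" and "w' = nat w0"
  have u': "u' \<in> {1, 5, 7}" "int u' = u0" and w': "w' \<in> {3, 15, 21}" "int w' = w0"
    using u0(1) w0(1) by (auto simp: u'_def w'_def)
  have "jump 54 S d \<longleftrightarrow> jump 54 {u', 18 - u', 18 + u', w'} d" for d
  proof -
    have "u' \<le> 18" using u' by auto
    from jump_circ[OF this, of w' d] show ?thesis
      unfolding u' w' jump using cong_pm_rewrite[OF u0(2), of d] cong_pm_rewrite[OF w0(2), of d] by blast
  qed
  then have "S = {u', 18 - u', 18 + u', w'}"
    using circulant is_circulant_circ[OF u'(1) w'(1)] unfolding n circ_def
    by (intro jumps_eq_of_jump[of 54]) simp_all
  then have "(n, S) = circ u' w'" by (simp add: n circ_def)
  with u' w' show ?thesis by blast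
qed

section \<open>Isomorphisms of Type 1 and Type 2\<close>

lemma bij_betw_endoI:
  assumes "inj_on f A" "f ` A \<subseteq> A" "finite A"
  shows "bij_betw f A A"
  using assms endo_inj_surj unfolding bij_betw_def by blast

lemma reflexive_reduction_cong:
  assumes "0 < n"
  shows "[int (reflexive_reduction n k) = int k] (mod int n) \<or>
   [int (reflexive_reduction n k) = - int k] (mod int n)"
proof (cases "2 * (k mod n) > n")
  case True
  have "k mod n \<le> n"
    using assms by (simp add: less_imp_le)
  then have "[int (n - k mod n) = - int (k mod n)] (mod int n)"
    by (simp add: of_nat_diff cong_iff_dvd_diff del: of_nat_mod zmod_int)
  moreover have "[- int (k mod n) = - int k] (mod int n)"
    by (simp add: cong_minus_minus_iff zmod_int)
  ultimately show ?thesis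
    using True cong_trans by (auto simp: reflexive_reduction_def)
next
  case False
  then show ?thesis by (simp add: reflexive_reduction_def zmod_int)
qed

lemma jump_mult_jumps:
  assumes "coprime x n" "0 < n"
  shows "jump n (mult_jumps n x R) (int x * d) \<longleftrightarrow> jump n R d"
proof -
  have x: "coprime (int x) (int n)" using assms by simp
  have "[int x * d = int (reflexive_reduction n (x * r))] (mod int n) \<or>
        [int x * d = - int (reflexive_reduction n (x * r))] (mod int n) \<longleftrightarrow>
        [d = int r] (mod int n) \<or> [d = - int r] (mod int n)" for r
    unfolding cong_pm_rewrite[OF reflexive_reduction_cong[OF assms(2)]]
    using cong_mult_lcancel[OF x, of d "int r"] cong_mult_lcancel[OF x, of d "- int r"] by simp
  then show ?thesis by (simp add: jump_def mult_jumps_def)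
qed

lemma type1_iso_imp_isomorphic:
  assumes "type1_iso C D"
  shows "isomorphic C D"
  using assms
proof cases
  case (1 n R S x)
  then have x: "coprime x n" and n: "0 < n" by (auto simp: totatives_def is_circulant_def)
  let ?f = "\<lambda>i. (x * i) mod n"
  have bij: "bij_betw ?f {0..<n} {0..<n}"
  proof (rule bij_betw_endoI)
    show "inj_on ?f {0..<n}"
    proof (rule inj_onI)
      fix i j assume ij: "i \<in> {0..<n}" "j \<in> {0..<n}" "(x * i) mod n = (x * j) mod n"
      then have "[i = j] (mod n)"
        using cong_mult_lcancel_nat[OF x] by (simp add: cong_def)
      with ij show "i = j" by (simp add: cong_def)
    qed
  qed (use n in auto)
  have "jump n R (int j - int i) \<longleftrightarrow> jump n S (int (?f j) - int (?f i))" for i j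
  proof -
    have "[int (?f j) - int (?f i) = int x * (int j - int i)] (mod int n)"
      by (simp add: cong_def zmod_int mod_diff_eq right_diff_distrib)
    from jump_cong[OF this, of S] show ?thesis
      using jump_mult_jumps[OF x n, of R] 1 by simp
  qed
  then have "map_graph ?f (circulant_graph (n, R)) = circulant_graph (n, S)"
    by (intro map_circulant_graph bij)
  with bij show ?thesis unfolding 1 by (rule map_graph_imp_isomorphic)
qed

text \<open>The map keeps the residue modulo \<open>m\<close>, and on a fixed residue it is a translation.\<close>

lemma bij_betw_theta:
  assumes m: "m dvd n" and n: "0 < n"
  shows "bij_betw (theta n m t) {0..<n} {0..<n}"
proof (rule bij_betw_endoI)
  have res: "theta n m t x mod m = x mod m" for x
    using m by (simp add: theta_def mod_mod_cancel)
  show "inj_on (theta n m t) {0..<n}"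
  proof (rule inj_onI)
    fix x y assume xy: "x \<in> {0..<n}" "y \<in> {0..<n}" "theta n m t x = theta n m t y"
    then have "x mod m = y mod m" using res by metis
    with xy(3) have "[x + (x mod m) * t * m = y + (x mod m) * t * m] (mod n)"
      by (simp add: theta_def cong_def)
    then have "[x = y] (mod n)" by (simp only: cong_add_rcancel_nat)
    with xy show "x = y" by (simp add: cong_def)
  qed
qed (use n in \<open>auto simp: theta_def\<close>)

text \<open>The map changes a difference \<open>D\<close> to \<open>E = D + 6 s \<delta>\<close>, where \<open>\<delta>\<close> is the difference of the
  residues modulo 3. As \<open>\<delta>\<close> and \<open>D\<close> agree modulo 3, \<open>E\<close> and \<open>(1 + 6 s) D\<close> agree modulo 18; and \<open>\<delta>\<close>
  vanishes if 3 divides \<open>D\<close>, so that such differences do not change.\<close>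

lemma theta_circ:
  assumes u: "u \<le> 18" "u' \<le> 18" and w: "3 dvd w"
    and u': "[int u' = (1 + 6 * int s) * int u] (mod 18) \<or> [int u' = - ((1 + 6 * int s) * int u)] (mod 18)"
  shows "map_graph (theta 54 3 (2 * s)) (circulant_graph (circ u w)) = circulant_graph (circ u' w)"
  unfolding circ_def
proof (rule map_circulant_graph)
  show "bij_betw (theta 54 3 (2 * s)) {0..<54} {0..<54}"
    by (rule bij_betw_theta) simp_all
next
  fix x y :: nat
  let ?\<theta> = "theta 54 3 (2 * s)"
  define D where "D = int y - int x"
  define \<delta> where "\<delta> = int (y mod 3) - int (x mod 3)"
  define E where "E = D + 6 * int s * \<delta>"
  have E: "[int (?\<theta> y) - int (?\<theta> x) = E] (mod int 54)"
  proof -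
    have *: "[int (?\<theta> z) = int z + int (z mod 3) * (2 * int s) * 3] (mod 54)" for z
      by (simp add: theta_def zmod_int)
    show ?thesis
      using cong_diff[OF *[of y] *[of x]] by (simp add: E_def D_def \<delta>_def algebra_simps)
  qed
  have "[\<delta> = D] (mod 3)"
    unfolding \<delta>_def D_def zmod_int by (rule cong_diff) simp_all
  then have "3 dvd \<delta> - D"
    by (simp add: cong_iff_dvd_diff)
  then have "18 dvd 6 * int s * (\<delta> - D)"
    using mult_dvd_mono[of 6 "6 * int s" 3 "\<delta> - D"] by simp
  then have E18: "[E = (1 + 6 * int s) * D] (mod 18)"
    unfolding E_def by (simp add: cong_iff_dvd_diff algebra_simps)
  have "coprime (1 + 6 * int s) 18"
  proof -
    have "coprime (1 + 6 * int s) 6"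
      using cong_imp_coprime[of 1 "1 + 6 * int s" 6] by (simp add: cong_iff_dvd_diff)
    moreover have "coprime (1 + 6 * int s) 3"
      using cong_imp_coprime[of 1 "1 + 6 * int s" 3] by (simp add: cong_iff_dvd_diff)
    ultimately show ?thesis using coprime_mult_right_iff[of "1 + 6 * int s" 6 3] by simp
  qed
  note cancel = cong_mult_lcancel[OF this]
  have "[E = int u'] (mod 18) \<or> [E = - int u'] (mod 18) \<longleftrightarrow> [D = int u] (mod 18) \<or> [D = - int u] (mod 18)"
    unfolding cong_pm_rewrite[OF u']
    using cancel[of D "int u"] cancel[of D "- int u"] cong_rewrite[OF cong_sym[OF E18]]
      cong_trans[OF E18] cong_trans[OF cong_sym[OF E18]] by auto
  moreover have "[E = z] (mod 54) \<longleftrightarrow> [D = z] (mod 54)" if "3 dvd z" for z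
  proof -
    have "E = D" if "3 dvd D"
    proof -
      have "3 dvd \<delta>" using dvd_add[OF \<open>3 dvd \<delta> - D\<close> that] by simp
      moreover have "- 3 < \<delta>" "\<delta> < 3" unfolding \<delta>_def by linarith+
      ultimately have "\<delta> = 0" using dvd_imp_le_int[of \<delta> 3] by linarith
      then show ?thesis by (simp add: E_def)
    qed
    moreover have "3 dvd D" if "[D = z] (mod 54)"
      using cong_imp_dvd_iff[OF that, of 3] \<open>3 dvd z\<close> by simp
    moreover have "3 dvd D" if "[E = z] (mod 54)"
    proof -
      have "3 dvd E" using cong_imp_dvd_iff[OF that, of 3] \<open>3 dvd z\<close> by simp
      moreover have "3 dvd 6 * int s * \<delta>" by (intro dvd_mult2) simp
      ultimately have "3 dvd E - 6 * int s * \<delta>" by (rule dvd_diff)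
      then show ?thesis by (simp add: E_def)
    qed
    ultimately show ?thesis by metis
  qed
  moreover have "3 dvd int w" "3 dvd - int w"
    using w int_dvd_int_iff[of 3 w] by simp_all
  ultimately show "jump 54 {u, 18 - u, 18 + u, w} (int y - int x) \<longleftrightarrow>
      jump 54 {u', 18 - u', 18 + u', w} (int (?\<theta> y) - int (?\<theta> x))"
    unfolding jump_cong[OF E] jump_circ[OF u(1)] jump_circ[OF u(2)] D_def[symmetric] by blast
qed

text \<open>A multiplier prime to 54 preserves divisibility by 3, and this tells the jump \<open>w\<close> from
  the other ones.\<close>

lemma mult_jumps_circ:
  assumes u: "u \<in> {1, 5, 7}" "u' \<in> {1, 5, 7}" and w: "w \<in> {3, 15, 21}" "w' \<in> {3, 15, 21}"
    and x: "x \<in> totatives 54"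
    and eq: "{u', 18 - u', 18 + u', w'} = mult_jumps 54 x {u, 18 - u, 18 + u, w}"
  shows "([int x * int u = int u'] (mod 18) \<or> [int x * int u = - int u'] (mod 18)) \<and>
    ([int x * int w = int w'] (mod 54) \<or> [int x * int w = - int w'] (mod 54))"
proof -
  have u18: "u \<le> 18" "u' \<le> 18" using u by auto
  have cop: "coprime x 54" using x by (simp add: totatives_def)
  then have "\<not> 3 dvd x"
    using coprime_common_divisor[of x 54 3] by auto
  then have x3: "\<not> 3 dvd int x" using int_dvd_int_iff[of 3 x] by simp
  have u3: "\<not> 3 dvd int u" "\<not> 3 dvd int u'" and w3: "3 dvd int w" "3 dvd int w'"
    using u w by auto
  have jump: "jump 54 {u', 18 - u', 18 + u', w'} (int x * d) \<longleftrightarrow> jump 54 {u, 18 - u, 18 + u, w} d" for d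
    unfolding eq by (rule jump_mult_jumps[OF cop]) simp
  have "\<not> 3 dvd int x * int u"
    using x3 u3 by (simp add: prime_dvd_mult_iff)
  moreover have "3 dvd z" if "[z = int w'] (mod 54) \<or> [z = - int w'] (mod 54)" for z
    using that w3 cong_imp_dvd_iff[of z "int w'" 54 3] cong_imp_dvd_iff[of z "- int w'" 54 3] by auto
  moreover have "jump 54 {u', 18 - u', 18 + u', w'} (int x * int u)"
    unfolding jump jump_circ[OF u18(1)] by simp
  ultimately have xu: "[int x * int u = int u'] (mod 18) \<or> [int x * int u = - int u'] (mod 18)"
    unfolding jump_circ[OF u18(2)] by blast
  have "3 dvd int x * int w" using w3 by simp
  moreover have "\<not> 3 dvd z" if "[z = int u'] (mod 18) \<or> [z = - int u'] (mod 18)" for z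
    using that u3 cong_imp_dvd_iff[of z "int u'" 18 3] cong_imp_dvd_iff[of z "- int u'" 18 3] by auto
  moreover have "jump 54 {u', 18 - u', 18 + u', w'} (int x * int w)"
    unfolding jump jump_circ[OF u18(1)] by simp
  ultimately have "[int x * int w = int w'] (mod 54) \<or> [int x * int w = - int w'] (mod 54)"
    unfolding jump_circ[OF u18(2)] by blast
  with xu show ?thesis by blast
qed

text \<open>The units \<open>1 + 6 s\<close> are 1, 7 and 13 modulo 18. Up to sign, multiplication by 7 permutes 1, 7, 5
  cyclically, and 13 is the inverse of 7.\<close>

lemma theta_connects:
  assumes u: "u \<in> {1, 5, 7}" "u' \<in> {1, 5, 7}" and w: "w \<in> {3, 15, 21}"
  obtains s where "s \<le> 2"
    "map_graph (theta 54 3 (2 * s)) (circulant_graph (circ u w)) = circulant_graph (circ u' w)"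
proof -
  have "u = u' \<or> (u, u') \<in> {(1, 7), (7, 5), (5, 1)} \<or> (u, u') \<in> {(1, 5), (5, 7), (7, 1)}"
    using u by auto
  then obtain s :: nat where s: "s \<le> 2"
    "[int u' = (1 + 6 * int s) * int u] (mod 18) \<or> [int u' = - ((1 + 6 * int s) * int u)] (mod 18)"
  proof (elim disjE)
    assume "u = u'"
    then show thesis using that[of 0] by simp
  next
    assume "(u, u') \<in> {(1, 7), (7, 5), (5, 1)}"
    then show thesis using that[of 1] by (auto simp: cong_def)
  next
    assume "(u, u') \<in> {(1, 5), (5, 7), (7, 1)}"
    then show thesis using that[of 2] by (auto simp: cong_def)
  qed
  moreover have "u \<le> 18" "u' \<le> 18" "3 dvd w" using u w by auto
  ultimately show thesis using that theta_circ by blast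
qed

lemma circ_isomorphic_same_w:
  assumes u: "u \<in> {1, 5, 7}" "u' \<in> {1, 5, 7}" and w: "w \<in> {3, 15, 21}"
  shows "isomorphic (circ u w) (circ u' w)"
proof -
  obtain s where "map_graph (theta 54 3 (2 * s)) (circulant_graph (circ u w)) = circulant_graph (circ u' w)"
    using theta_connects[OF assms] by blast
  then show ?thesis
    using map_graph_imp_isomorphic[OF bij_betw_theta[of 3 54 "2 * s"]] unfolding circ_def by simp
qed

text \<open>The isomorphism is not of Type 1: a multiplier that fixes \<open>w\<close> up to sign modulo 54 is \<open>\<plusminus>1\<close>
  modulo 18, since \<open>w\<close> is 3 times a unit, so it fixes \<open>u\<close> up to sign too.\<close>

lemma type2_circ:
  assumes u: "u \<in> {1, 5, 7}" "u' \<in> {1, 5, 7}" "u \<noteq> u'" and w: "w \<in> {3, 15, 21}"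
  shows "type2_iso 3 (circ u w) (circ u' w)"
proof -
  obtain s where s: "s \<le> 2"
    "map_graph (theta 54 3 (2 * s)) (circulant_graph (circ u w)) = circulant_graph (circ u' w)"
    using theta_connects[OF u(1,2) w] by blast
  have no_type1: "{u', 18 - u', 18 + u', w} \<noteq> mult_jumps 54 x {u, 18 - u, 18 + u, w}"
    if "x \<in> totatives 54" for x
  proof
    assume "{u', 18 - u', 18 + u', w} = mult_jumps 54 x {u, 18 - u, 18 + u, w}"
    note xu = mult_jumps_circ[OF u(1,2) w w that this]
    define v :: int where "v = int (w div 3)"
    have v: "v \<in> {1, 5, 7}" "int w = 3 * v"
      using w unfolding v_def by (elim insertE emptyE; simp)+
    from v(1) have "coprime v 18" by (intro coprime_18)
    then have "[int x = 1] (mod 18) \<or> [int x = - 1] (mod 18)"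
      using conjunct2[OF xu] cong_54_cancel[of "int x" v 1] cong_54_cancel[of "int x" v "- 1"]
      unfolding v(2) by auto
    then have "[int x * int u = 1 * int u] (mod 18) \<or> [int x * int u = - 1 * int u] (mod 18)"
      using cong_mult[OF _ cong_refl] by blast
    then have "[int x * int u = int u] (mod 18) \<or> [int x * int u = - int u] (mod 18)"
      by simp
    from cong_pm_trans[OF this conjunct1[OF xu]]
    have "[int u = int u'] (mod 18) \<or> [int u = - int u'] (mod 18)" .
    with u show False by (auto simp: cong_def)
  qed
  show ?thesis
    unfolding circ_def
  proof (rule type2_iso.base[where r = w and t = "2 * s"])
    show "is_circulant (54, {u, 18 - u, 18 + u, w})" "is_circulant (54, {u', 18 - u', 18 + u', w})"
      using is_circulant_circ[of _ w] u w unfolding circ_def by blast+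
    show "3 \<le> card {u, 18 - u, 18 + u, w}"
      using u w by auto
    show "map_graph (theta 54 3 (2 * s)) (circulant_graph (54, {u, 18 - u, 18 + u, w})) =
        circulant_graph (54, {u', 18 - u', 18 + u', w})"
      using s(2) unfolding circ_def .
    show "\<forall>y\<in>totatives 54. {u', 18 - u', 18 + u', w} \<noteq> mult_jumps 54 y {u, 18 - u, 18 + u, w}"
      using no_type1 by blast
  qed (use w s(1) in auto)
qed

lemma type1_circ_5:
  assumes "(u, u') \<in> {(1, 5), (5, 7), (7, 1)}" "(w, w') \<in> {(3, 15), (15, 21), (21, 3)}"
  shows "type1_iso (circ u w) (circ u' w')"
  unfolding circ_def
proof (rule type1_iso.intros[where x = 5])
  show "is_circulant (54, {u, 18 - u, 18 + u, w})" "is_circulant (54, {u', 18 - u', 18 + u', w'})"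
    using assms by (auto simp: is_circulant_def)
  show "(5::nat) \<in> totatives 54"
    unfolding totatives_def by (simp only: mem_Collect_eq) code_simp
  show "{u', 18 - u', 18 + u', w'} = mult_jumps 54 5 {u, 18 - u, 18 + u, w}"
    using assms by (auto simp: mult_jumps_def reflexive_reduction_def)
qed

lemma type1_circ_11:
  assumes "(u, u') \<in> {(5, 1), (7, 5), (1, 7)}" "(w, w') \<in> {(15, 3), (21, 15), (3, 21)}"
  shows "type1_iso (circ u w) (circ u' w')"
  unfolding circ_def
proof (rule type1_iso.intros[where x = 11])
  show "is_circulant (54, {u, 18 - u, 18 + u, w})" "is_circulant (54, {u', 18 - u', 18 + u', w'})"
    using assms by (auto simp: is_circulant_def)
  show "(11::nat) \<in> totatives 54"
    unfolding totatives_def by (simp only: mem_Collect_eq) code_simp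
  show "{u', 18 - u', 18 + u', w'} = mult_jumps 54 11 {u, 18 - u, 18 + u, w}"
    using assms by (auto simp: mult_jumps_def reflexive_reduction_def)
qed

text \<open>The map fixes all multiples of \<open>m\<close>, in particular 0 and \<open>r\<close>, hence the edge between them.
  That the jumps have greatest common divisor 1 rules out proper scalings, which can have
  multiples of \<open>m\<close> among their jumps only because of the scaling factor.\<close>

lemma type2_iso_preserves_multiples:
  assumes "type2_iso m C D" "Gcd (snd C) = 1" "r \<in> snd C" "m dvd r"
  shows "r \<in> snd D"
  using assms
proof (induction rule: type2_iso.induct)
  case (base n R S r' t)
  then have r: "1 \<le> r" "2 * r \<le> n" and n: "0 < n"
    by (auto simp: is_circulant_def)
  have "jump n R (int r - int 0)"
    using mem_iff_jump[OF base(1)] base.prems by simp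
  then have "{0, r} \<in> edges (circulant_graph (n, R))"
    using r n by (subst edge_iff_jump) auto
  from imageI[OF this, of "(`) (theta n m t)"]
  have "theta n m t ` {0, r} \<in> edges (circulant_graph (n, S))"
    unfolding base(9)[symmetric] by simp
  moreover have "theta n m t ` {0, r} = {0, r}"
    using r n base.prems by (simp add: theta_def)
  ultimately have "jump n S (int r - int 0)"
    using r n by (subst edge_iff_jump[symmetric]) auto
  with r show ?case
    using mem_iff_jump[OF base(2), of r] by simp
next
  case (scale n R S k)
  then have "k dvd Gcd ((\<lambda>r. k * r) ` R)" by (intro Gcd_greatest) auto
  with scale have "k = 1" by simp
  with scale show ?case by simp
qed

lemma isomorphism_seriesI:
  assumes len: "length Cs = Suc (length ts)" and "hd Cs = C"
    and "\<forall>D\<in>set Cs. is_circulant D \<and> isomorphic C D"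
    and steps: "\<forall>(t, A, B)\<in>set (zip ts (zip Cs (tl Cs))). iso_of_type t A B"
    and alt: "successively (\<noteq>) ts"
    and dist: "distinct (zip ts (map2 (\<lambda>A B. {A, B}) Cs (tl Cs)))"
  shows "isomorphism_series C Cs ts"
  unfolding isomorphism_series_def
proof (intro conjI)
  show "\<forall>i<length ts. iso_of_type (ts ! i) (Cs ! i) (Cs ! Suc i)"
  proof (intro allI impI)
    fix i assume "i < length ts"
    then have "(ts ! i, Cs ! i, Cs ! Suc i) \<in> set (zip ts (zip Cs (tl Cs)))"
      using len by (auto simp: set_zip nth_tl)
    with steps show "iso_of_type (ts ! i) (Cs ! i) (Cs ! Suc i)" by blast
  qed
  show "\<forall>i. Suc i < length ts \<longrightarrow> ts ! Suc i \<noteq> ts ! i"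
    using alt by (auto simp: successively_conv_nth)
  show "\<forall>i j. i < j \<and> j < length ts \<and> ts ! i = ts ! j \<longrightarrow> {Cs ! i, Cs ! Suc i} \<noteq> {Cs ! j, Cs ! Suc j}"
  proof (intro allI impI)
    fix i j assume ij: "i < j \<and> j < length ts \<and> ts ! i = ts ! j"
    have nth: "zip ts (map2 (\<lambda>A B. {A, B}) Cs (tl Cs)) ! k = (ts ! k, {Cs ! k, Cs ! Suc k})"
      if "k < length ts" for k
      using that len by (simp add: nth_tl)
    have "zip ts (map2 (\<lambda>A B. {A, B}) Cs (tl Cs)) ! i \<noteq> zip ts (map2 (\<lambda>A B. {A, B}) Cs (tl Cs)) ! j"
      using dist ij len by (subst nth_eq_iff_index_eq) simp_all
    then show "{Cs ! i, Cs ! Suc i} \<noteq> {Cs ! j, Cs ! Suc j}"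
      using ij nth by simp
  qed
  show "Cs ! 0 = C" using assms(1,2) by (cases Cs) simp_all
qed (use assms in auto)

section \<open>The isomorphic set and the series\<close>

lemma circ_isomorphic:
  assumes u: "u \<in> {1, 5, 7}" "u' \<in> {1, 5, 7}" and w: "w \<in> {3, 15, 21}" "w' \<in> {3, 15, 21}"
  shows "isomorphic (circ u w) (circ u' w')"
proof -
  have base: "isomorphic (circ 1 3) (circ u w)" if "u \<in> {1, 5, 7}" "w \<in> {3, 15, 21}" for u w
  proof -
    have "isomorphic (circ 1 3) (circ 5 15)"
      by (intro type1_iso_imp_isomorphic type1_circ_5) simp_all
    moreover have "isomorphic (circ 5 15) (circ 7 21)"
      by (intro type1_iso_imp_isomorphic type1_circ_5) simp_all
    ultimately have "\<exists>u0\<in>{1, 5, 7}. isomorphic (circ 1 3) (circ u0 w)"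
      using that(2) isomorphic_refl isomorphic_trans by blast
    then obtain u0 where u0: "u0 \<in> {1, 5, 7}" "isomorphic (circ 1 3) (circ u0 w)" by blast
    from u0(2) circ_isomorphic_same_w[OF u0(1) that] show ?thesis by (rule isomorphic_trans)
  qed
  show ?thesis
    using base[OF u(1) w(1)] base[OF u(2) w(2)] isomorphic_sym isomorphic_trans by blast
qed

lemma isomorphic_set_circ:
  assumes u: "u \<in> {1, 5, 7}" and w: "w \<in> {3, 15, 21}"
  shows "isomorphic_set (circ u w) = {circ u' w' | u' w'. u' \<in> {1, 5, 7} \<and> w' \<in> {3, 15, 21}}"
proof (intro equalityI subsetI)
  fix D assume "D \<in> isomorphic_set (circ u w)"
  then have D: "is_circulant D" "isomorphic (circ u w) D"
    by (auto simp: isomorphic_set_def)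
  have "isomorphic (circ 1 3) (circ u w)"
    using u w by (intro circ_isomorphic) simp_all
  then have "isomorphic (circ 1 3) D" using D(2) by (rule isomorphic_trans)
  then show "D \<in> {circ u' w' | u' w'. u' \<in> {1, 5, 7} \<and> w' \<in> {3, 15, 21}}"
    using circ_classification[of "fst D" "snd D"] D(1) by auto
next
  fix D assume "D \<in> {circ u' w' | u' w'. u' \<in> {1, 5, 7} \<and> w' \<in> {3, 15, 21}}"
  then show "D \<in> isomorphic_set (circ u w)"
    using circ_isomorphic[OF u _ w] is_circulant_circ unfolding isomorphic_set_def by blast
qed

lemma isomorphic_set_circ_nine:
  assumes u: "u \<in> {1, 5, 7}" and w: "w \<in> {3, 15, 21}"
  shows "isomorphic_set (circ u w) =
    {circ 1 3, circ 1 15, circ 1 21, circ 5 3, circ 7 3, circ 5 15, circ 5 21, circ 7 15, circ 7 21}"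
  unfolding isomorphic_set_circ[OF assms] by blast

lemma circ_eq_iff:
  assumes "u \<in> {1, 5, 7}" "u' \<in> {1, 5, 7}" "w \<in> {3, 15, 21}" "w' \<in> {3, 15, 21}"
  shows "circ u w = circ u' w' \<longleftrightarrow> u = u' \<and> w = w'"
proof
  assume "circ u w = circ u' w'"
  then have "{u, 18 - u, 18 + u, w} = {u', 18 - u', 18 + u', w'}" by (simp add: circ_def)
  then have "u \<in> {u', 18 - u', 18 + u', w'}" "w \<in> {u', 18 - u', 18 + u', w'}" by blast+
  moreover have "u < 18 - u'" "u < 18 + u'"
    using assms(1,2) by auto
  moreover have "\<not> 3 dvd u"
    using assms(1) by auto
  moreover have "\<not> 3 dvd u'" "\<not> 3 dvd 18 - u'" "\<not> 3 dvd 18 + u'"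
    using assms(2) by auto
  moreover have "3 dvd w" "3 dvd w'"
    using assms(3,4) by auto
  ultimately show "u = u' \<and> w = w'"
    unfolding insert_iff empty_iff by (metis less_irrefl)
qed simp

lemma circ_nine:
  "(54, {1, 3, 17, 19}) = circ 1 3" "(54, {1, 15, 17, 19}) = circ 1 15"
  "(54, {1, 17, 19, 21}) = circ 1 21" "(54, {3, 5, 13, 23}) = circ 5 3"
  "(54, {5, 13, 15, 23}) = circ 5 15" "(54, {5, 13, 21, 23}) = circ 5 21"
  "(54, {3, 7, 11, 25}) = circ 7 3" "(54, {7, 11, 15, 25}) = circ 7 15"
  "(54, {7, 11, 21, 25}) = circ 7 21"
  by (auto simp: circ_def)

lemma not_type1:
  "\<not> type1_iso (circ 1 3) (circ 7 15)" "\<not> type1_iso (circ 7 15) (circ 1 3)"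
proof -
  have *: "\<exists>x. ([x * int u = int u'] (mod 18) \<or> [x * int u = - int u'] (mod 18)) \<and>
    ([x * int w = int w'] (mod 54) \<or> [x * int w = - int w'] (mod 54))"
    if "type1_iso (circ u w) (circ u' w')"
      "u \<in> {1, 5, 7}" "u' \<in> {1, 5, 7}" "w \<in> {3, 15, 21}" "w' \<in> {3, 15, 21}" for u w u' w'
    using that(1) unfolding circ_def
  proof cases
    case (1 x)
    then show ?thesis using mult_jumps_circ[OF that(2-5), of x] by blast
  qed
  show "\<not> type1_iso (circ 1 3) (circ 7 15)"
  proof
    assume "type1_iso (circ 1 3) (circ 7 15)"
    from *[OF this] obtain x :: int
      where "[x = 7] (mod 18) \<or> [x = - 7] (mod 18)" "[x * 3 = 15] (mod 54) \<or> [x * 3 = - 15] (mod 54)"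
      by auto
    then show False
      using cong_54_cancel[of x 1 5] cong_54_cancel[of x 1 "- 5"] by (auto simp: cong_def)
  qed
  show "\<not> type1_iso (circ 7 15) (circ 1 3)"
  proof
    assume "type1_iso (circ 7 15) (circ 1 3)"
    from *[OF this] obtain x :: int
      where x: "[x * 7 = 1] (mod 18) \<or> [x * 7 = - 1] (mod 18)"
        "[x * 15 = 3] (mod 54) \<or> [x * 15 = - 3] (mod 54)"
      by auto
    have "[3 = 11 * (3 * 5)] (mod (54::int))" "[- 3 = - 11 * (3 * 5)] (mod (54::int))"
      by (simp_all add: cong_def)
    with x(2) have "[x * (3 * 5) = 11 * (3 * 5)] (mod 54) \<or> [x * (3 * 5) = - 11 * (3 * 5)] (mod 54)"
      by (auto intro: cong_trans)
    then have "[x = 11] (mod 18) \<or> [x = - 11] (mod 18)"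
      using cong_54_cancel[OF _ coprime_18[of 5]] by blast
    then have "[x * 7 = 11 * 7] (mod 18) \<or> [x * 7 = - 11 * 7] (mod 18)"
      using cong_mult[OF _ cong_refl] by blast
    with x(1) show False by (auto simp: cong_def)
  qed
qed

lemma Gcd_circ_jumps:
  "Gcd (snd (circ 1 3)) = 1" "Gcd (snd (circ 7 15)) = 1"
proof -
  show "Gcd (snd (circ 1 3)) = 1" by (simp add: circ_def)
  have "Gcd (snd (circ 7 15)) dvd 7" "Gcd (snd (circ 7 15)) dvd 15"
    by (rule Gcd_dvd; simp add: circ_def)+
  then have "Gcd (snd (circ 7 15)) dvd 15 - 2 * 7"
    by (intro dvd_diff_nat dvd_mult)
  then show "Gcd (snd (circ 7 15)) = 1" by simp
qed

lemma not_type2: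
  "\<not> type2_iso 3 (circ 1 3) (circ 7 15)" "\<not> type2_iso 3 (circ 7 15) (circ 1 3)"
  using type2_iso_preserves_multiples[OF _ Gcd_circ_jumps(1), of 3 "circ 7 15" 3]
    type2_iso_preserves_multiples[OF _ Gcd_circ_jumps(2), of 3 "circ 1 3" 15]
  by (auto simp: circ_def)

lemma circ_series:
  "isomorphism_series (circ 1 3) [circ 1 3, circ 5 15, circ 7 15] [Type1, Type2]"
  "isomorphism_series (circ 1 3) [circ 1 3, circ 5 3, circ 7 15] [Type2, Type1]"
  "isomorphism_series (circ 1 3)
    [circ 1 3, circ 5 15, circ 7 15, circ 1 21, circ 5 21, circ 7 3, circ 5 3]
    [Type1, Type2, Type1, Type2, Type1, Type2]"
  "isomorphism_series (circ 1 3)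
    [circ 1 3, circ 5 3, circ 7 15, circ 1 15, circ 5 21, circ 7 21, circ 5 15]
    [Type2, Type1, Type2, Type1, Type2, Type1]"
  "isomorphism_series (circ 7 15) [circ 7 15, circ 5 3, circ 1 3] [Type1, Type2]"
  "isomorphism_series (circ 7 15) [circ 7 15, circ 5 15, circ 1 3] [Type2, Type1]"
  "isomorphism_series (circ 7 15)
    [circ 7 15, circ 5 3, circ 1 3, circ 5 15, circ 1 15, circ 5 21, circ 1 21]
    [Type1, Type2, Type1, Type2, Type1, Type2]"
  "isomorphism_series (circ 7 15)
    [circ 7 15, circ 5 15, circ 1 3, circ 5 3, circ 1 21, circ 5 21, circ 1 15]
    [Type2, Type1, Type2, Type1, Type2, Type1]"
proof -
  have type2: "\<exists>m. type2_iso m (circ u w) (circ u' w)"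
    if "u \<in> {1, 5, 7}" "u' \<in> {1, 5, 7}" "u \<noteq> u'" "w \<in> {3, 15, 21}" for u u' w
    using type2_circ[OF that] by blast
  note facts = is_circulant_circ circ_isomorphic circ_eq_iff type1_circ_5 type1_circ_11 type2
    doubleton_eq_iff
  show
  "isomorphism_series (circ 1 3) [circ 1 3, circ 5 15, circ 7 15] [Type1, Type2]"
  "isomorphism_series (circ 1 3) [circ 1 3, circ 5 3, circ 7 15] [Type2, Type1]"
  "isomorphism_series (circ 1 3)
    [circ 1 3, circ 5 15, circ 7 15, circ 1 21, circ 5 21, circ 7 3, circ 5 3]
    [Type1, Type2, Type1, Type2, Type1, Type2]"
  "isomorphism_series (circ 1 3)
    [circ 1 3, circ 5 3, circ 7 15, circ 1 15, circ 5 21, circ 7 21, circ 5 15]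
    [Type2, Type1, Type2, Type1, Type2, Type1]"
  "isomorphism_series (circ 7 15) [circ 7 15, circ 5 3, circ 1 3] [Type1, Type2]"
  "isomorphism_series (circ 7 15) [circ 7 15, circ 5 15, circ 1 3] [Type2, Type1]"
  "isomorphism_series (circ 7 15)
    [circ 7 15, circ 5 3, circ 1 3, circ 5 15, circ 1 15, circ 5 21, circ 1 21]
    [Type1, Type2, Type1, Type2, Type1, Type2]"
  "isomorphism_series (circ 7 15)
    [circ 7 15, circ 5 15, circ 1 3, circ 5 3, circ 1 21, circ 5 21, circ 1 15]
    [Type2, Type1, Type2, Type1, Type2, Type1]"
    by (intro isomorphism_seriesI; simp add: facts del: One_nat_def)+
qed

section \<open>The two graphs\<close>

theorem mainTheorem3:
  shows "
     isomorphic (54, {1, 3, 17, 19}) (54, {7, 11, 15, 25}) \<and>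
     \<not> type1_iso (54, {1, 3, 17, 19}) (54, {7, 11, 15, 25}) \<and>
     \<not> type1_iso (54, {7, 11, 15, 25}) (54, {1, 3, 17, 19}) \<and>
     \<not> type2_iso 3 (54, {1, 3, 17, 19}) (54, {7, 11, 15, 25}) \<and>
     \<not> type2_iso 3 (54, {7, 11, 15, 25}) (54, {1, 3, 17, 19}) \<and>
     isomorphic_set (54, {1, 3, 17, 19}) =
       {(54, {1, 3, 17, 19}), (54, {1, 15, 17, 19}), (54, {1, 17, 19, 21}),
        (54, {3, 5, 13, 23}), (54, {3, 7, 11, 25}), (54, {5, 13, 15, 23}),
        (54, {5, 13, 21, 23}), (54, {7, 11, 15, 25}), (54, {7, 11, 21, 25})} \<and>
     isomorphic_set (54, {7, 11, 15, 25}) =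
       {(54, {1, 3, 17, 19}), (54, {1, 15, 17, 19}), (54, {1, 17, 19, 21}),
        (54, {3, 5, 13, 23}), (54, {3, 7, 11, 25}), (54, {5, 13, 15, 23}),
        (54, {5, 13, 21, 23}), (54, {7, 11, 15, 25}), (54, {7, 11, 21, 25})} \<and>
     isomorphism_series (54, {1, 3, 17, 19})
       [(54, {1, 3, 17, 19}), (54, {5, 13, 15, 23}), (54, {7, 11, 15, 25})]
       [Type1, Type2] \<and>
     isomorphism_series (54, {1, 3, 17, 19})
       [(54, {1, 3, 17, 19}), (54, {3, 5, 13, 23}), (54, {7, 11, 15, 25})]
       [Type2, Type1] \<and>
     isomorphism_series (54, {1, 3, 17, 19})
       [(54, {1, 3, 17, 19}), (54, {5, 13, 15, 23}), (54, {7, 11, 15, 25}),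
        (54, {1, 17, 19, 21}), (54, {5, 13, 21, 23}), (54, {3, 7, 11, 25}),
        (54, {3, 5, 13, 23})]
       [Type1, Type2, Type1, Type2, Type1, Type2] \<and>
     isomorphism_series (54, {1, 3, 17, 19})
       [(54, {1, 3, 17, 19}), (54, {3, 5, 13, 23}), (54, {7, 11, 15, 25}),
        (54, {1, 15, 17, 19}), (54, {5, 13, 21, 23}), (54, {7, 11, 21, 25}),
        (54, {5, 13, 15, 23})]
       [Type2, Type1, Type2, Type1, Type2, Type1] \<and>
     isomorphism_series (54, {7, 11, 15, 25})
       [(54, {7, 11, 15, 25}), (54, {3, 5, 13, 23}), (54, {1, 3, 17, 19})]
       [Type1, Type2] \<and>
     isomorphism_series (54, {7, 11, 15, 25})
       [(54, {7, 11, 15, 25}), (54, {5, 13, 15, 23}), (54, {1, 3, 17, 19})]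
       [Type2, Type1] \<and>
     isomorphism_series (54, {7, 11, 15, 25})
       [(54, {7, 11, 15, 25}), (54, {3, 5, 13, 23}), (54, {1, 3, 17, 19}),
        (54, {5, 13, 15, 23}), (54, {1, 15, 17, 19}), (54, {5, 13, 21, 23}),
        (54, {1, 17, 19, 21})]
       [Type1, Type2, Type1, Type2, Type1, Type2] \<and>
     isomorphism_series (54, {7, 11, 15, 25})
       [(54, {7, 11, 15, 25}), (54, {5, 13, 15, 23}), (54, {1, 3, 17, 19}),
        (54, {3, 5, 13, 23}), (54, {1, 17, 19, 21}), (54, {5, 13, 21, 23}),
        (54, {1, 15, 17, 19})]
       [Type2, Type1, Type2, Type1, Type2, Type1]"
  unfolding circ_nine
  by (intro conjI not_type1 not_type2 circ_series circ_isomorphic isomorphic_set_circ_nine) simp_all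

end
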